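(* There exists a finitely generated group $G$ which admits a faithful action on the circle $S^1$ by orientation-preserving homeomorphisms (that is, an injective homomorphism $G \to \mathrm{Homeo}^+(S^1)$), but such that no faithful action $\rho: G \to \mathrm{Homeo}^+(S^1)$ is conjugate to a $C^1$ action.
   Context: $\mathrm{Homeo}^+(S^1)$ denotes the group of orientation-preserving homeomorphisms of the circle. An action $\rho: G\to \mathrm{Homeo}^+(S^1)$ is conjugate to a $C^1$ action if there is a homeomorphism $h$ of $S^1$ such that $h\rho(g)h^{-1}$ is a $C^1$ diffeomorphism of $S^1$ for every $g \in G$. *)

theory Defs
  imports
    "HOL-Analysis.Analysis"
    "HOL-Algebra.Bij"
    "HOL-Algebra.Generated_Groups"
begin

(* Such a group is countable, hence isomorphic to one whose carrier is a set of naturals: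
   quantifying over nat monoid ranges over all of them up to isomorphism. *)
definition finitely_generated_group :: "('a, 'b) monoid_scheme \<Rightarrow> bool" where
  "finitely_generated_group G \<longleftrightarrow>
     group G \<and> (\<exists>S. finite S \<and> S \<subseteq> carrier G \<and> generate G S = carrier G)"

abbreviation S1 :: "complex set" where
  "S1 \<equiv> sphere 0 1"

(* A circle homeomorphism preserves orientation iff it lifts, through the
   covering t |-> cis t of S1 by the real line, to an increasing map. *)
definition orientation_preserving_S1 :: "(complex \<Rightarrow> complex) \<Rightarrow> bool" where
  "orientation_preserving_S1 f \<longleftrightarrow>
     (\<exists>F :: real \<Rightarrow> real. continuous_on UNIV F \<and> strict_mono F \<and> (\<forall>t. f (cis t) = cis (F t)))"

(* Elements are extensional functions (undefined outside S1), so that equality in the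
   group is equality of maps of the circle; multiplication is composition on S1. *)
definition HomeoPlus_S1 :: "(complex \<Rightarrow> complex) monoid" where
  "HomeoPlus_S1 = BijGroup S1
     \<lparr>carrier := {f \<in> Bij S1. (\<exists>g. homeomorphism S1 S1 f g) \<and> orientation_preserving_S1 f}\<rparr>"

(* As cis is a smooth covering, hence a local diffeomorphism onto S1, a map f on S1 is
   C^1 iff its composition with cis is C^1 as a map from the reals to the plane. *)
definition C1_on_S1 :: "(complex \<Rightarrow> complex) \<Rightarrow> bool" where
  "C1_on_S1 f \<longleftrightarrow> (\<lambda>t. f (cis t)) C1_differentiable_on UNIV"

definition C1_diffeo_S1 :: "(complex \<Rightarrow> complex) \<Rightarrow> bool" where
  "C1_diffeo_S1 f \<longleftrightarrow> (\<exists>g. homeomorphism S1 S1 f g \<and> C1_on_S1 f \<and> C1_on_S1 g)"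

(* The conjugating homeomorphism h (with inverse k) may reverse orientation. *)
definition conjugate_to_C1_action ::
    "('a, 'b) monoid_scheme \<Rightarrow> ('a \<Rightarrow> complex \<Rightarrow> complex) \<Rightarrow> bool" where
  "conjugate_to_C1_action G \<rho> \<longleftrightarrow>
     (\<exists>h k. homeomorphism S1 S1 h k \<and> (\<forall>g \<in> carrier G. C1_diffeo_S1 (h \<circ> \<rho> g \<circ> k)))"

lemma subgroup_HomeoPlus_S1: "subgroup (carrier HomeoPlus_S1) (BijGroup S1)"
proof -
  interpret B: group "BijGroup S1" by (rule group_BijGroup)
  show ?thesis
  proof (rule B.subgroupI)
    show "carrier HomeoPlus_S1 \<subseteq> carrier (BijGroup S1)"
      by (auto simp: HomeoPlus_S1_def BijGroup_def)
    have "homeomorphism S1 S1 (\<lambda>x\<in>S1. x) id"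
      by (rule homeomorphism_cong[OF homeomorphism_ident]) auto
    moreover have "orientation_preserving_S1 (\<lambda>x\<in>S1. x)"
      unfolding orientation_preserving_S1_def
      by (rule exI[of _ id]) (auto simp: strict_mono_def)
    ultimately have "(\<lambda>x\<in>S1. x) \<in> carrier HomeoPlus_S1"
      using id_Bij by (auto simp: HomeoPlus_S1_def)
    then show "carrier HomeoPlus_S1 \<noteq> {}" by blast
  next
    fix f assume f: "f \<in> carrier HomeoPlus_S1"
    then have fB: "f \<in> Bij S1" by (simp add: HomeoPlus_S1_def)
    obtain g F where g: "homeomorphism S1 S1 f g" and F: "continuous_on UNIV F" "strict_mono F"
      and lift: "\<And>t. f (cis t) = cis (F t)"
      using f by (auto simp: HomeoPlus_S1_def orientation_preserving_S1_def)
    define i where "i = (\<lambda>x\<in>S1. inv_into S1 f x)"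
    have inv: "inv\<^bsub>BijGroup S1\<^esub> f = i"
      using inv_BijGroup[OF fB] by (simp add: i_def)
    have iB: "i \<in> Bij S1" unfolding i_def by (rule restrict_inv_into_Bij[OF fB])
    have inj: "inj_on f S1" using fB by (simp add: Bij_def bij_betw_def)
    have ig: "i x = g x" if "x \<in> S1" for x
      unfolding i_def using that g inj
      by (metis homeomorphism_apply2 homeomorphism_def image_eqI inv_into_f_f restrict_apply')
    have "homeomorphism S1 S1 i f"
      using homeomorphism_cong[OF homeomorphism_symD[OF g], of S1 S1 i f] ig by simp
    moreover have "orientation_preserving_S1 i"
    proof -
      have "F (t + 2 * pi) > F t" for t using F(2) by (simp add: strict_mono_def)
      have per: "\<exists>n::int. n \<ge> 1 \<and> F (t + 2*pi) = F t + of_int n * (2 * pi)" for t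
      proof -
        have "cis (F (t + 2*pi)) = cis (F t)"
          using lift[of "t + 2*pi"] lift[of t] by (simp add: cis_mult[symmetric])
        then obtain n :: int where n: "F (t + 2*pi) = F t + 2 * pi * of_int n"
          using sin_cos_eq_iff[of "F (t + 2*pi)" "F t"] by (auto simp: complex_eq_iff)
        have "2 * pi * of_int n > 0" using \<open>F (t + 2*pi) > F t\<close> n by simp
        then have "n \<ge> 1" by (simp add: zero_less_mult_iff)
        with n show ?thesis by (auto simp: mult.commute)
      qed
      have step: "F (t + 2*pi) \<ge> F t + 2*pi" for t
      proof -
        obtain n :: int where "n \<ge> 1" "F (t + 2*pi) = F t + of_int n * (2 * pi)" using per by blast
        then show ?thesis using mult_right_mono[of 1 "real_of_int n" "2*pi"] by simp
      qed
      have up: "F (real m * (2*pi)) \<ge> F 0 + real m * (2*pi)" for m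
      proof (induction m)
        case (Suc m)
        then show ?case using step[of "real m * (2*pi)"] by (simp add: algebra_simps)
      qed simp
      have down: "F (- (real m * (2*pi))) \<le> F 0 - real m * (2*pi)" for m
      proof (induction m)
        case (Suc m)
        then show ?case using step[of "- (real (Suc m) * (2*pi))"] by (simp add: algebra_simps)
      qed simp
      have surj: "\<exists>t. F t = y" for y
      proof -
        obtain m :: nat where m: "real m > \<bar>y - F 0\<bar> / (2*pi)" using reals_Archimedean2 by blast
        then have m': "real m * (2*pi) > \<bar>y - F 0\<bar>" by (simp add: field_simps)
        have "\<exists>t\<ge>- (real m * (2*pi)). t \<le> real m * (2*pi) \<and> F t = y"
          using up[of m] down[of m] m' F(1)
          by (intro IVT') (auto intro: continuous_on_subset)
        then show ?thesis by blast
      qed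
      have "bij F" using surj F(2) strict_mono_imp_inj_on by (metis bijI surj_def)
      define K where "K = inv_into UNIV F"
      have FK: "F (K y) = y" for y using \<open>bij F\<close> by (simp add: K_def bij_is_surj surj_f_inv_f)
      have KF: "K (F t) = t" for t using \<open>bij F\<close> by (simp add: K_def bij_is_inj inv_f_f)
      have Kmono: "strict_mono K"
        by (metis F(2) FK strict_mono_def strict_mono_less)
      have "isCont K y" for y
      proof -
        have "isCont K (F (K y))"
          using F(1) KF by (intro isCont_inverse_function[of 1 "K y" K F])
             (auto simp: continuous_on_eq_continuous_at)
        then show ?thesis by (simp add: FK)
      qed
      then have "continuous_on UNIV K" by (simp add: continuous_on_eq_continuous_at)
      moreover have "i (cis t) = cis (K t)" for t
      proof -
        have "i (cis t) = i (f (cis (K t)))" by (simp add: lift FK)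
        also have "\<dots> = cis (K t)"
          using ig[of "f (cis (K t))"] homeomorphism_apply1[OF g, of "cis (K t)"] by (simp add: lift)
        finally show ?thesis .
      qed
      ultimately show ?thesis using Kmono unfolding orientation_preserving_S1_def by blast
    qed
    ultimately show "inv\<^bsub>BijGroup S1\<^esub> f \<in> carrier HomeoPlus_S1"
      using iB inv by (auto simp: HomeoPlus_S1_def)
  next
    fix f g assume f: "f \<in> carrier HomeoPlus_S1" and g: "g \<in> carrier HomeoPlus_S1"
    have B: "f \<in> Bij S1" "g \<in> Bij S1" using f g by (auto simp: HomeoPlus_S1_def)
    obtain f' g' where h: "homeomorphism S1 S1 f f'" "homeomorphism S1 S1 g g'"
      using f g by (auto simp: HomeoPlus_S1_def)
    obtain F H where FH: "continuous_on UNIV F" "strict_mono F" "\<And>t. f (cis t) = cis (F t)"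
      "continuous_on UNIV H" "strict_mono H" "\<And>t. g (cis t) = cis (H t)"
      using f g by (auto simp: HomeoPlus_S1_def orientation_preserving_S1_def)
    have "homeomorphism S1 S1 (compose S1 f g) (g' \<circ> f')"
      using homeomorphism_cong[OF homeomorphism_compose[OF h(2) h(1)], of S1 S1 "compose S1 f g"]
      by (simp add: compose_def)
    moreover have "orientation_preserving_S1 (compose S1 f g)"
      unfolding orientation_preserving_S1_def
    proof (intro exI conjI allI)
      show "continuous_on UNIV (F \<circ> H)"
        using FH(1,4) by (intro continuous_on_compose) (auto intro: continuous_on_subset)
      show "strict_mono (F \<circ> H)" using FH(2,5) by (simp add: strict_mono_def)
      show "compose S1 f g (cis t) = cis ((F \<circ> H) t)" for t by (simp add: compose_def FH)
    qed
    ultimately show "f \<otimes>\<^bsub>BijGroup S1\<^esub> g \<in> carrier HomeoPlus_S1"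
      using B compose_Bij[OF B] by (auto simp: HomeoPlus_S1_def BijGroup_def)
  qed
qed

lemma group_HomeoPlus_S1: "group HomeoPlus_S1"
  using group.subgroup_imp_group[OF group_BijGroup subgroup_HomeoPlus_S1]
  by (simp add: HomeoPlus_S1_def)

end

(* Take two commuting copies of the group L generated by lifts to the line of the parabolic matrices
   u = (1 1; 0 1) and v = (1 0; 1/18 1), acting on two disjoint arcs of the circle. A word w in
   a = u^3 and b = v^3 represents the diagonal matrix (2, 1/2), so w u = u^4 w and w v^4 = v w also hold
   for the lifts that have fixed points.

   In any circle action, a map conjugate to its fourth power has a cube with a fixed point: lift the
   cube E so that E itself is conjugate to E^4; without a fixed point the displacement of E^(4^n) would
   grow like 4^n, yet it stays bounded. If a and b have no common fixed point, then a gap between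
   Fix a and Fix b is preserved by everything that commutes with both and has a fixed point, so the
   cubes of the other copy have a common fixed point. Hence one copy has a, b with a common fixed
   point.

   If the action is C^1, the relations w a = a^4 w and w b^4 = b w force the derivatives of a and b
   at such a point to be 1, and then, as in Thurston's stability theorem, force their first order
   displacements to vanish. So a and b are trivial near the point, hence everywhere by connectedness,
   and the action is not faithful. *)
theory Submission
  imports Defs
begin

section \<open>Increasing maps of the line commuting with a translation\<close>

text \<open>The cubes come from the ambiguity of lifts. A relation \<open>h u = u^4 h\<close> on the
  circle lifts only up to a multiple of 2 pi; since 4 - 1 = 3, changing the lift of \<open>u\<close>
  absorbs this multiple only if it is divisible by 3, whereas a lift of \<open>u^3\<close> can
  always absorb it. This is also why \<open>w\<close> is spelled in \<open>a\<close> and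
  \<open>b\<close>: only the cubes are known to have fixed points, and a word in them fixes whatever
  they fix in common.

  One copy of L is not enough for the argument. On the circle of lines in the plane the two shears
  act analytically and fix different lines, so nothing forces a common fixed point; the commuting
  second copy does. Lifts replace matrices because an action on the line fits into an open arc,
  which leaves room for the other copy.

  The constants come from one matrix computation: if x y = 1/2, then for a = (1 x; 0 1) and b = (1
  0; y 1) the product a a b^-1 a b b a^-1 is diagonal with entries 2 and 1/2. Conjugation by it
  multiplies upper entries by 4 and divides lower ones by 4. The choice x = 3, y = 1/6 has the cube
  roots with entries 1 and 1/18.\<close>

definition degree_one :: "real \<Rightarrow> (real \<Rightarrow> real) \<Rightarrow> bool" where
  "degree_one P F \<longleftrightarrow> continuous_on UNIV F \<and> strict_mono F \<and> (\<forall>x. F (x + P) = F x + P)"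

lemma degree_one_mono: "degree_one P F \<Longrightarrow> F x < F y \<longleftrightarrow> x < y"
  by (simp add: degree_one_def strict_mono_less)

lemma degree_one_mono_le: "degree_one P F \<Longrightarrow> F x \<le> F y \<longleftrightarrow> x \<le> y"
  by (simp add: degree_one_def strict_mono_less_eq)

lemma degree_one_eq: "degree_one P F \<Longrightarrow> F x = F y \<longleftrightarrow> x = y"
  by (simp add: degree_one_def strict_mono_eq)

lemma degree_one_cont: "degree_one P F \<Longrightarrow> continuous_on A F"
  using continuous_on_subset by (fastforce simp: degree_one_def)

lemma degree_one_nat:
  assumes "degree_one P F"
  shows "F (x + of_nat n * P) = F x + of_nat n * P"
proof (induction n)
  case (Suc n)
  have "F (x + of_nat (Suc n) * P) = F ((x + of_nat n * P) + P)" by (simp add: algebra_simps)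
  also have "\<dots> = F x + of_nat (Suc n) * P"
    using Suc assms unfolding degree_one_def by (auto simp: distrib_right)
  finally show ?case .
qed simp

lemma degree_one_int:
  assumes "degree_one P F"
  shows "F (x + of_int k * P) = F x + of_int k * P"
proof (cases k)
  case (nonneg n)
  then show ?thesis using degree_one_nat[OF assms, of x n] by simp
next
  case (neg n)
  then have k: "of_int k = - real (Suc n)" by simp
  show ?thesis using degree_one_nat[OF assms, of "x + of_int k * P" "Suc n"]
    unfolding k by (simp add: algebra_simps)
qed

lemma degree_one_comp: "degree_one P F \<Longrightarrow> degree_one P G \<Longrightarrow> degree_one P (F \<circ> G)"
  unfolding degree_one_def
  by (auto simp: strict_mono_def intro: continuous_on_compose2[of UNIV F UNIV G])

lemma degree_one_shift:
  assumes "degree_one P F"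
  shows "degree_one P (\<lambda>x. F x + of_int k * P)"
  using assms unfolding degree_one_def by (auto simp: strict_mono_def intro!: continuous_intros)

lemma degree_one_fixpoint_int:
  assumes "degree_one P F" "F p = p"
  shows "F (p + of_int k * P) = p + of_int k * P"
  using degree_one_int[OF assms(1)] assms(2) by simp

lemma period_cell:
  assumes "P > (0::real)"
  obtains k :: int where "p + of_int k * P \<le> x" "x < p + of_int k * P + P"
proof
  let ?k = "\<lfloor>(x - p) / P\<rfloor>"
  have "of_int ?k \<le> (x - p) / P" "(x - p) / P < of_int ?k + 1" by linarith+
  then show "p + of_int ?k * P \<le> x" "x < p + of_int ?k * P + P"
    using assms unfolding pos_le_divide_eq[OF assms] pos_divide_less_eq[OF assms]
    by (simp_all add: distrib_right)
qed

text \<open>The translates of the fixed point cut the line into invariant cells of length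
  \<open>P\<close>, so no point can leave its cell.\<close>

lemma degree_one_fixpoint_displacement:
  assumes F: "degree_one P F" "F p = p" and P: "P > 0"
  shows "\<bar>F x - x\<bar> < P"
proof -
  obtain k :: int where k: "p + of_int k * P \<le> x" "x < p + of_int k * P + P"
    using period_cell[OF P] .
  have "p + of_int k * P \<le> F x"
    using degree_one_mono_le[OF F(1), of "p + of_int k * P" x] k(1) degree_one_fixpoint_int[OF F]
    by simp
  moreover have "F x < p + of_int k * P + P"
    using degree_one_mono[OF F(1), of x "p + of_int (k+1) * P"] k(2)
      degree_one_fixpoint_int[OF F, of "k+1"] by (simp add: algebra_simps)
  ultimately show ?thesis using k by linarith
qed

lemma int_multiple_small:
  assumes "P > (0::real)" "\<bar>of_int k * P\<bar> < P" shows "k = 0"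
proof -
  have "\<bar>real_of_int k\<bar> < 1" using assms by (simp add: abs_mult)
  then show ?thesis by linarith
qed

text \<open>At a fixed point of \<open>U\<close> the multiple of \<open>P\<close> must be 0, because
  \<open>W\<close> moves every point by less than \<open>P\<close>; so \<open>H\<close> carries
  fixed points of \<open>U\<close> to fixed points of \<open>W\<close>. Between two such points one
  period apart, both sides stay in the same cell and cannot differ by a nonzero multiple. This makes
  relations exact after lifting, with \<open>P\<close> = pi for matrices acting on lines and
  \<open>P\<close> = 2 pi for circle maps.\<close>

lemma intertwine_of_mod_period:
  assumes H: "degree_one P H" and U: "degree_one P U" "U p = p"
    and W: "degree_one P W" "W q = q" and P: "P > 0"
    and mod: "\<And>x. \<exists>k::int. H (U x) = W (H x) + of_int k * P"
  shows "H (U x) = W (H x)"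
proof -
  have Wp: "W (H y) = H y" if y: "U y = y" for y
  proof -
    obtain k :: int where k: "H (U y) = W (H y) + of_int k * P" using mod by blast
    have "\<bar>of_int k * P\<bar> < P"
      using degree_one_fixpoint_displacement[OF W P, of "H y"] k y by simp
    then have "k = 0" by (rule int_multiple_small[OF P])
    then show ?thesis using k y by simp
  qed
  obtain k :: int where k: "p + of_int k * P \<le> x" "x < p + of_int k * P + P"
    using period_cell[OF P] .
  define r where "r = p + of_int k * P"
  have r: "U r = r" "U (r + P) = r + P"
    using degree_one_fixpoint_int[OF U, of k] degree_one_fixpoint_int[OF U, of "k+1"]
    by (simp_all add: r_def algebra_simps)
  have HP: "H (r + P) = H r + P" using H by (simp add: degree_one_def)
  have "r \<le> x" "x < r + P" using k by (simp_all add: r_def)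
  then have "r \<le> U x" "U x < r + P" "H r \<le> H x" "H x < H r + P"
    using degree_one_mono_le[OF U(1), of r x] degree_one_mono[OF U(1), of x "r+P"] r
      degree_one_mono_le[OF H, of r x] degree_one_mono[OF H, of x "r+P"] HP by auto
  then have "H r \<le> H (U x)" "H (U x) < H r + P" "H r \<le> W (H x)" "W (H x) < H r + P"
    using degree_one_mono_le[OF H, of r "U x"] degree_one_mono[OF H, of "U x" "r+P"] HP
      degree_one_mono_le[OF W(1), of "H r" "H x"] degree_one_mono[OF W(1), of "H x" "H (r+P)"]
      Wp[OF r(1)] Wp[OF r(2)] by auto
  moreover obtain m :: int where m: "H (U x) = W (H x) + of_int m * P" using mod by blast
  ultimately have "\<bar>of_int m * P\<bar> < P" by linarith
  then have "m = 0" by (rule int_multiple_small[OF P])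
  then show ?thesis using m by simp
qed

section \<open>Fixed points of maps conjugate to their fourth power\<close>

lemma no_positive_displacement:
  assumes E: "degree_one P E" and H: "degree_one P H" and P: "P > 0"
    and rel: "\<And>x. H (E x) = E (E (E (E (H x))))"
  shows "\<exists>x. E x \<le> x"
proof (rule ccontr)
  assume "\<not> ?thesis"
  then have pos: "E x > x" for x by (meson not_le)
  \<comment> \<open>The displacement is periodic, so its minimum over one period is a uniform
    positive lower bound \<open>e\<close>.\<close>
  have "\<exists>x\<in>{0..P}. \<forall>y\<in>{0..P}. E x - x \<le> E y - y"
    using P by (intro continuous_attains_inf continuous_intros degree_one_cont[OF E]) auto
  then obtain c where c: "\<And>y. y \<in> {0..P} \<Longrightarrow> E c - c \<le> E y - y" by blast
  define e where "e = E c - c"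
  have e: "e > 0" using pos by (simp add: e_def)
  have step: "x + e \<le> E x" for x
  proof -
    obtain k :: int where k: "0 + of_int k * P \<le> x" "x < 0 + of_int k * P + P"
      using period_cell[OF P] .
    then have "e \<le> E (x + of_int (-k) * P) - (x + of_int (-k) * P)"
      unfolding e_def by (intro c) auto
    then show ?thesis using degree_one_int[OF E, of x "-k"] by simp
  qed
  have up: "x + of_nat n * e \<le> (E ^^ n) x" for n x
  proof (induction n)
    case (Suc n)
    then show ?case using step[of "(E ^^ n) x"] by (simp add: algebra_simps)
  qed simp
  have rel2: "H ((E ^^ n) x) = (E ^^ (4 * n)) (H x)" for n x
    by (induction n) (simp_all add: rel eval_nat_numeral)
  have rel3: "(H ^^ n) (E x) = (E ^^ (4 ^ n)) ((H ^^ n) x)" for n x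
    by (induction n) (simp_all add: rel2)
  \<comment> \<open>\<open>K\<close> periods bound the displacement of \<open>E\<close> at 0. Since
    \<open>H ^^ n\<close> commutes with translation by \<open>P\<close>, the same bound holds
    between the images of 0 and \<open>E 0\<close>, whatever \<open>n\<close> is; by
    \<open>rel3\<close> this is a displacement of \<open>E ^^ (4 ^ n)\<close>.\<close>
  obtain K :: nat where K: "(E 0 - 0) / P < real K" using reals_Archimedean2 by blast
  have "real (4 ^ n) * e \<le> real K * P" for n
  proof -
    have Hn: "degree_one P (H ^^ n)"
      by (induction n) (use H degree_one_comp in \<open>auto simp: degree_one_def strict_mono_def\<close>)
    have "E 0 \<le> 0 + real K * P" using K P by (simp add: field_simps)
    then have "(H ^^ n) (E 0) \<le> (H ^^ n) (0 + real K * P)"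
      using degree_one_mono_le[OF Hn] by blast
    also have "\<dots> = (H ^^ n) 0 + real K * P" by (rule degree_one_nat[OF Hn])
    finally show ?thesis using up[of "(H ^^ n) 0" "4 ^ n"] rel3[of n 0] by simp
  qed
  moreover obtain n where "real K * P / e < real (4 ^ n)"
  proof -
    obtain n :: nat where n: "real K * P / e < real n" using reals_Archimedean2 by blast
    have "n < 4 ^ n" by (rule less_exp[THEN less_le_trans]) (simp add: power_mono)
    then have "real n < real (4 ^ n)" by (rule less_imp_of_nat_less)
    with n have "real K * P / e < real (4 ^ n)" by linarith
    then show ?thesis by (rule that)
  qed
  ultimately show False using e by (metis not_less pos_divide_less_eq)
qed

lemma quadrupled_has_fixpoint:
  assumes E: "degree_one P E" and H: "degree_one P H" and P: "P > 0"
    and rel: "\<And>x. H (E x) = E (E (E (E (H x))))"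
  shows "\<exists>x. E x = x"
proof -
  obtain a where a: "E a \<le> a" using no_positive_displacement[OF E H P rel] by blast
  \<comment> \<open>Conjugation by the reflection of the line reverses the sign of displacements and
    keeps the relation. Hence displacements of both signs occur, and the intermediate value theorem
    applies.\<close>
  have neg: "degree_one P (\<lambda>x. - F (- x))" if F: "degree_one P F" for F
  proof -
    have "F (- x - P) = F (- x) - P" for x
      using degree_one_int[OF F, of "-x" "-1"] by simp
    moreover have "continuous_on UNIV (\<lambda>x. F (- x))"
      using degree_one_cont[OF F, of UNIV]
      by (rule continuous_on_compose2) (auto intro!: continuous_intros)
    ultimately show ?thesis using F
      unfolding degree_one_def by (auto simp: strict_mono_def intro!: continuous_intros)
  qed
  have "\<exists>x. - E (- x) \<le> x"
    by (rule no_positive_displacement[OF neg[OF E] neg[OF H] P]) (simp add: rel)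
  then obtain b where b: "b \<le> E b" by (metis minus_le_iff)
  have "\<exists>x. E x - x = 0"
  proof (cases "a \<le> b")
    case True
    then have "\<exists>x\<ge>a. x \<le> b \<and> E x - x = 0"
      using a b by (intro IVT') (auto intro!: continuous_intros degree_one_cont[OF E])
    then show ?thesis by blast
  next
    case False
    then have "\<exists>x\<ge>b. x \<le> a \<and> E x - x = 0"
      using a b by (intro IVT2') (auto intro!: continuous_intros degree_one_cont[OF E])
    then show ?thesis by blast
  qed
  then show ?thesis by simp
qed

text \<open>If \<^term>\<open>C\<close> moved the endpoint of the gap, the iterates of the two endpoints would interlace and
  converge to a common point of \<^term>\<open>X\<close> and \<^term>\<open>Y\<close>.\<close>
lemma gap_not_moved_right:
  assumes C: "degree_one P C" "C c = c" and P: "P > 0"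
    and X: "closed X" "\<And>x. x \<in> X \<Longrightarrow> C x \<in> X" and Y: "closed Y" "\<And>x. x \<in> Y \<Longrightarrow> C x \<in> Y"
    and disj: "X \<inter> Y = {}" and x: "x \<in> X" and y: "y \<in> Y" and xy: "x < y"
    and gap: "{x<..<y} \<inter> X = {}"
  shows "C x \<le> x"
proof (rule ccontr)
  assume "\<not> C x \<le> x"
  then have Cx: "x < C x" by simp
  have "C x \<in> X" using X x by blast
  then have yC: "y < C x" using gap Cx disj y
    by (metis disjoint_iff greaterThanLessThan_iff linorder_neqE_linordered_idom)
  define u where "u n = (C ^^ n) x" for n
  define v where "v n = (C ^^ n) y" for n
  have uv: "u n < v n \<and> v n < u (Suc n)" for n
  proof (induction n)
    case 0 then show ?case using xy yC by (simp add: u_def v_def)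
  next
    case (Suc n)
    then show ?case
      using degree_one_mono[OF C(1), of "u n" "v n"] degree_one_mono[OF C(1), of "v n" "u (Suc n)"]
      by (simp add: u_def v_def)
  qed
  \<comment> \<open>A translate \<open>d\<close> of the fixed point \<open>c\<close>, taken to the
    right of \<open>x\<close>, bounds the increasing orbit of \<open>x\<close>.\<close>
  obtain k :: int where k: "x - P + of_int k * P \<le> c" "c < x - P + of_int k * P + P"
    using period_cell[OF P] .
  define d where "d = c + of_int (1 - k) * P"
  have d: "C d = d" "x \<le> d"
    using degree_one_fixpoint_int[OF C, of "1 - k"] k P by (simp_all add: d_def algebra_simps)
  have ud: "u n \<le> d" for n
  proof (induction n)
    case (Suc n)
    then show ?case using degree_one_mono_le[OF C(1), of "u n" d] d by (simp add: u_def)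
  qed (simp add: u_def d)
  have "incseq u" using uv by (intro incseq_SucI) (meson less_imp_le less_trans)
  then obtain l where l: "u \<longlonglongrightarrow> l"
    using incseq_convergent[of u d] ud by blast
  have l': "(\<lambda>n. u (Suc n)) \<longlonglongrightarrow> l" using l by (rule LIMSEQ_Suc)
  have "v \<longlonglongrightarrow> l"
    by (rule tendsto_sandwich[OF _ _ l l']) (use uv less_imp_le in \<open>auto intro!: always_eventually\<close>)
  moreover have "u n \<in> X" "v n \<in> Y" for n
    by (induction n) (auto simp: u_def v_def x y X Y)
  ultimately have "l \<in> X" "l \<in> Y"
    using closed_sequentially[OF X(1)] closed_sequentially[OF Y(1)] l by blast+
  then show False using disj by blast
qed

lemma degree_one_surj:
  assumes F: "degree_one P F" and P: "P > 0"
  shows "surj F"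
proof -
  have "\<exists>x. F x = y" for y
  proof -
    obtain k :: int where k: "F 0 + of_int k * P \<le> y" "y < F 0 + of_int k * P + P"
      using period_cell[OF P] .
    then have "F (0 + of_int k * P) \<le> y" "y \<le> F (0 + of_int (k + 1) * P)"
      unfolding degree_one_int[OF F] by (simp_all add: algebra_simps)
    then have "\<exists>x\<ge>0 + of_int k * P. x \<le> 0 + of_int (k+1) * P \<and> F x = y"
      using P by (intro IVT' degree_one_cont[OF F]) (auto simp: algebra_simps)
    then show ?thesis by blast
  qed
  then show ?thesis by (metis surjI)
qed

lemma strict_mono_surj_continuous:
  fixes F :: "real \<Rightarrow> real"
  assumes "strict_mono F" "surj F"
  shows "continuous_on UNIV F"
  using assms by (intro continuous_onI_mono) (auto simp: strict_mono_less_eq)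

lemma degree_one_inv:
  assumes F: "degree_one P F" and P: "P > 0"
  shows "degree_one P (inv_into UNIV F)" "F (inv_into UNIV F x) = x" "inv_into UNIV F (F x) = x"
proof -
  have inj: "inj F" using degree_one_eq[OF F] by (auto intro: injI)
  show s: "F (inv_into UNIV F x) = x" for x using degree_one_surj[OF assms] by (rule surj_f_inv_f)
  show i: "inv_into UNIV F (F x) = x" for x using inj by (rule inv_f_f)
  have m: "strict_mono (inv_into UNIV F)" unfolding strict_mono_def using s degree_one_mono[OF F] by metis
  moreover have "surj (inv_into UNIV F)" using i by (rule surjI)
  moreover have "inv_into UNIV F (x + P) = inv_into UNIV F x + P" for x
    using F s i by (metis degree_one_def)
  ultimately show "degree_one P (inv_into UNIV F)"
    unfolding degree_one_def by (auto intro: strict_mono_surj_continuous)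
qed

lemma closed_fixpoints:
  fixes F :: "real \<Rightarrow> real"
  assumes "degree_one P F" shows "closed {x. F x = x}"
  using degree_one_cont[OF assms] by (intro closed_Collect_eq continuous_intros)

text \<open>The point is the left end of a gap: \<open>y\<close> is the first fixed point of
  \<open>B\<close> to the right of \<open>p\<close>, and \<open>x\<close> the last fixed point of
  \<open>A\<close> before \<open>y\<close>. A map commuting with \<open>A\<close> and
  \<open>B\<close> preserves both fixed point sets, and so does its inverse; applying the gap lemma
  to both leaves only \<open>C x = x\<close>. The gap depends on \<open>A\<close> and
  \<open>B\<close> alone, so one point serves all such maps.\<close>

lemma fixpoint_dichotomy:
  assumes P: "P > 0" and A: "degree_one P A" "A p = p" and B: "degree_one P B" "B q = q"
    and no: "\<And>x. \<not> (A x = x \<and> B x = x)"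
  obtains x where "\<And>C c. degree_one P C \<Longrightarrow> C c = c \<Longrightarrow> (\<And>x. C (A x) = A (C x)) \<Longrightarrow>
     (\<And>x. C (B x) = B (C x)) \<Longrightarrow> C x = x"
proof -
  define X where "X = {x. A x = x}"
  define Y where "Y = {x. B x = x}"
  have cl: "closed X" "closed Y" using A B by (auto simp: X_def Y_def intro: closed_fixpoints)
  have disj: "X \<inter> Y = {}" using no by (auto simp: X_def Y_def)
  have p: "p \<in> X" using A by (simp add: X_def)
  obtain k :: int where k: "p + of_int k * P \<le> q" "q < p + of_int k * P + P"
    using period_cell[OF P] .
  define r where "r = q + of_int (1 - k) * P"
  have r: "r \<in> Y" "p < r"
    using degree_one_fixpoint_int[OF B, of "1 - k"] k P by (simp_all add: r_def Y_def algebra_simps)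
  define y where "y = Inf (Y \<inter> {p..})"
  have y: "y \<in> Y \<inter> {p..}" unfolding y_def
    using cl r by (intro closed_contains_Inf) auto
  have ymin: "y \<le> z" if "z \<in> Y" "p \<le> z" for z
    unfolding y_def using that by (intro cInf_lower) auto
  define x where "x = Sup (X \<inter> {..y})"
  have x: "x \<in> X \<inter> {..y}" unfolding x_def
    using cl p y by (intro closed_contains_Sup) auto
  have xmax: "z \<le> x" if "z \<in> X" "z \<le> y" for z
    unfolding x_def using that by (intro cSup_upper) auto
  have xy: "x < y" using x y disj by (metis IntD1 IntD2 atMost_iff disjoint_iff le_less)
  have "p \<le> x" using xmax p y by simp
  have gapX: "{x<..<y} \<inter> X = {}" using xmax by fastforce
  show ?thesis
  proof
    fix C c assume C: "degree_one P C" "C c = c"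
      and com: "\<And>x. C (A x) = A (C x)" "\<And>x. C (B x) = B (C x)"
    note I = degree_one_inv[OF C(1) P]
    have "C x \<le> x"
      using x y xy gapX com by (intro gap_not_moved_right[OF C P cl(1) _ cl(2) _ disj])
        (auto simp: X_def Y_def, metis+)
    moreover have com': "inv_into UNIV C (A z) = A (inv_into UNIV C z)" "inv_into UNIV C (B z) = B (inv_into UNIV C z)" for z
      using com I by metis+
    have "inv_into UNIV C c = c" using C I by metis
    then have "inv_into UNIV C x \<le> x"
      using x y xy gapX com' by (intro gap_not_moved_right[OF I(1) _ P cl(1) _ cl(2) _ disj])
        (auto simp: X_def Y_def, metis+)
    then have "x \<le> C x" using degree_one_mono_le[OF C(1), of "inv_into UNIV C x" x] I by simp
    ultimately show "C x = x" by simp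
  qed
qed


section \<open>Lifts of circle homeomorphisms\<close>

definition circle_lift :: "(complex \<Rightarrow> complex) \<Rightarrow> (real \<Rightarrow> real) \<Rightarrow> bool" where
  "circle_lift f F \<longleftrightarrow> degree_one (2 * pi) F \<and> (\<forall>t. f (cis t) = cis (F t))"

lemma circle_cis: "z \<in> S1 \<Longrightarrow> cis (Arg z) = z"
  using rcis_cmod_Arg[of z] by (simp add: rcis_def)

lemma cis_eq_imp:
  assumes "cis x = cis y"
  shows "\<exists>k::int. x = y + of_int k * (2 * pi)"
  using assms sin_cos_eq_iff[of x y] by (auto simp: complex_eq_iff mult.commute)

lemma cis_shift: "cis (x + of_int k * (2 * pi)) = cis x"
  by (simp add: cis_mult[symmetric] mult.commute[of _ "2 * pi"])

lemma mult_HomeoPlus_S1: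
  "f \<in> carrier HomeoPlus_S1 \<Longrightarrow> g \<in> carrier HomeoPlus_S1 \<Longrightarrow>
    f \<otimes>\<^bsub>HomeoPlus_S1\<^esub> g = compose S1 f g"
  by (simp add: HomeoPlus_S1_def BijGroup_def)

lemma one_HomeoPlus_S1: "\<one>\<^bsub>HomeoPlus_S1\<^esub> = (\<lambda>x\<in>S1. x)"
  by (simp add: HomeoPlus_S1_def BijGroup_def)

lemma HomeoPlus_S1_closed:
  "f \<in> carrier HomeoPlus_S1 \<Longrightarrow> z \<in> S1 \<Longrightarrow> f z \<in> S1"
  by (auto simp: HomeoPlus_S1_def Bij_def bij_betw_def)

lemma HomeoPlus_S1_ext:
  assumes "f \<in> carrier HomeoPlus_S1" "g \<in> carrier HomeoPlus_S1" "\<And>z. z \<in> S1 \<Longrightarrow> f z = g z"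
  shows "f = g"
  using assms by (intro extensionalityI[of f S1 g]) (auto simp: HomeoPlus_S1_def Bij_def)

text \<open>An increasing lift satisfies \<open>F (t + 2 * pi) = F t + 2 * pi * n\<close> with n at
  least 1. If n were 2 or more, \<open>F\<close> would reach \<open>F t + 2 * pi\<close> strictly
  inside the period, and \<open>f\<close> would identify two points of the circle.\<close>

lemma circle_lift_exists:
  assumes "f \<in> carrier HomeoPlus_S1"
  obtains F where "circle_lift f F"
proof -
  obtain F where F: "continuous_on UNIV F" "strict_mono F" and lift: "\<And>t. f (cis t) = cis (F t)"
    using assms by (auto simp: HomeoPlus_S1_def orientation_preserving_S1_def)
  have inj: "inj_on f S1" using assms by (auto simp: HomeoPlus_S1_def Bij_def bij_betw_def)
  have "F (t + 2 * pi) = F t + 2 * pi" for t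
  proof -
    have "cis (F (t + 2*pi)) = cis (F t)"
      using lift[of "t + 2*pi"] lift[of t] by (simp add: cis_mult[symmetric])
    then obtain n :: int where n: "F (t + 2*pi) = F t + of_int n * (2 * pi)"
      using cis_eq_imp by blast
    have "F t < F (t + 2*pi)" using F(2) by (simp add: strict_mono_def)
    then have "n \<ge> 1" using n by (simp add: zero_less_mult_iff)
    moreover have "n \<le> 1"
    proof (rule ccontr)
      assume "\<not> n \<le> 1"
      then have "n \<ge> 2" by simp
      then have "real_of_int n * (2 * pi) \<ge> 2 * (2 * pi)"
        by (intro mult_right_mono) auto
      then have 2: "F (t + 2*pi) > F t + 2 * pi" using n pi_gt_zero by linarith
      then have "\<exists>s\<ge>t. s \<le> t + 2 * pi \<and> F s = F t + 2 * pi"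
        using F(1) by (intro IVT') (auto intro: continuous_on_subset)
      then obtain s where s: "t \<le> s" "s \<le> t + 2 * pi" "F s = F t + 2 * pi" by blast
      have "f (cis s) = f (cis t)" using lift s by (simp add: cis_mult[symmetric])
      then have "cis s = cis t" using inj by (simp add: inj_on_def)
      then obtain k :: int where k: "s = t + of_int k * (2 * pi)" using cis_eq_imp by blast
      have "s \<noteq> t" "s \<noteq> t + 2 * pi" using s 2 by auto
      then have "0 < of_int k * (2 * pi)" "of_int k * (2 * pi) < 1 * (2 * pi)" using s k by linarith+
      then have "0 < real_of_int k" "real_of_int k < 1"
        by (simp_all add: zero_less_mult_iff)
      then show False by simp
    qed
    ultimately show ?thesis using n by simp
  qed
  then have "circle_lift f F" using F lift by (simp add: circle_lift_def degree_one_def)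
  then show ?thesis by (rule that)
qed

lemma circle_lift_mult:
  assumes "f \<in> carrier HomeoPlus_S1" "g \<in> carrier HomeoPlus_S1" "circle_lift f F" "circle_lift g G"
  shows "circle_lift (f \<otimes>\<^bsub>HomeoPlus_S1\<^esub> g) (F \<circ> G)"
  using assms by (auto simp: circle_lift_def mult_HomeoPlus_S1 compose_def intro: degree_one_comp)

text \<open>The circle is the image of a compact interval under \<open>cis\<close>. A closed set of
  parameters in that interval is compact, so its image is closed; thus preimages of closed sets
  under \<open>f\<close> are closed.\<close>

lemma continuous_on_circle:
  assumes "continuous_on UNIV (\<lambda>t. f (cis t))"
  shows "continuous_on S1 (f :: complex \<Rightarrow> complex)"
proof -
  have S: "cis ` {-pi..pi} = S1"
  proof
    show "S1 \<subseteq> cis ` {-pi..pi}"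
    proof
      fix z assume "z \<in> S1"
      then have "z = cis (Arg z)" by (rule circle_cis[symmetric])
      moreover have "Arg z \<in> {-pi..pi}" using Arg_bounded[of z] by auto
      ultimately show "z \<in> cis ` {-pi..pi}" by (rule image_eqI)
    qed
  qed auto
  show ?thesis unfolding continuous_on_closed_invariant
  proof (intro allI impI)
    fix T :: "complex set" assume T: "closed T"
    define K where "K = {-pi..pi} \<inter> (\<lambda>t. f (cis t)) -` T"
    have "closed K" unfolding K_def
      by (intro continuous_closed_preimage continuous_on_subset[OF assms] T) auto
    moreover have "bounded K" by (rule bounded_subset[of "{-pi..pi}"]) (auto simp: K_def)
    ultimately have "compact K" by (simp add: compact_eq_bounded_closed)
    then have "compact (cis ` K)" by (intro compact_continuous_image continuous_intros)
    then have "closed (cis ` K)" by (rule compact_imp_closed)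
    moreover have "cis ` K \<inter> S1 = f -` T \<inter> S1"
      unfolding K_def S[symmetric] by blast
    ultimately show "\<exists>A. closed A \<and> A \<inter> S1 = f -` T \<inter> S1" by blast
  qed
qed

lemma HomeoPlus_S1_of_lift:
  assumes ext: "f \<in> extensional S1" and lift: "circle_lift f F"
  shows "f \<in> carrier HomeoPlus_S1"
proof -
  have F: "degree_one (2 * pi) F" "\<And>t. f (cis t) = cis (F t)"
    using lift by (auto simp: circle_lift_def)
  have "continuous_on S1 f"
    using degree_one_cont[OF F(1), of UNIV]
    by (intro continuous_on_circle) (auto simp: F intro!: continuous_intros)
  moreover have "f ` S1 = S1"
  proof
    show "f ` S1 \<subseteq> S1"
    proof
      fix w assume "w \<in> f ` S1"
      then obtain z where "z \<in> S1" "w = f z" by blast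
      then have "w = cis (F (Arg z))" using F(2)[of "Arg z"] circle_cis[of z] by simp
      then show "w \<in> S1" by simp
    qed
    show "S1 \<subseteq> f ` S1"
    proof
      fix z assume z: "z \<in> S1"
      obtain t where t: "F t = Arg z"
        using degree_one_surj[OF F(1)] by (metis pi_gt_zero surj_def zero_less_mult_iff zero_less_numeral)
      have "z = f (cis t)" using F(2)[of t] t circle_cis[OF z] by simp
      then show "z \<in> f ` S1" by auto
    qed
  qed
  moreover have "inj_on f S1"
  proof (rule inj_onI)
    fix w z assume wz: "w \<in> S1" "z \<in> S1" "f w = f z"
    then have "cis (F (Arg w)) = cis (F (Arg z))" using F(2)[of "Arg w"] F(2)[of "Arg z"] circle_cis wz by simp
    then obtain k :: int where "F (Arg w) = F (Arg z) + of_int k * (2 * pi)"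
      using cis_eq_imp by blast
    then have "F (Arg w) = F (Arg z + of_int k * (2 * pi))" using degree_one_int[OF F(1)] by simp
    then have "Arg w = Arg z + of_int k * (2 * pi)" using degree_one_eq[OF F(1)] by blast
    then have "cis (Arg w) = cis (Arg z)" by (simp only: cis_shift)
    then show "w = z" using circle_cis wz by simp
  qed
  moreover obtain g where "homeomorphism S1 S1 f g"
    using homeomorphism_compact[of S1 f S1] calculation by auto
  ultimately show ?thesis using ext F
    by (auto simp: HomeoPlus_S1_def Bij_def bij_betw_def orientation_preserving_S1_def degree_one_def)
qed

text \<open>The difference of the lifts, divided by 2 pi, is a continuous integer-valued function on
  the connected line.\<close>

lemma circle_lift_unique:
  assumes "circle_lift f F" "circle_lift f G"
  obtains k :: int where "\<And>x. F x = G x + of_int k * (2 * pi)"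
proof -
  define d where "d x = (F x - G x) / (2 * pi)" for x
  have int: "d x \<in> \<int>" for x
  proof -
    have "cis (F x) = cis (G x)" using assms by (metis circle_lift_def)
    then obtain k :: int where "F x = G x + of_int k * (2 * pi)" using cis_eq_imp by blast
    then have "d x = of_int k" by (simp add: d_def)
    then show ?thesis by simp
  qed
  have "continuous_on UNIV d" unfolding d_def
    using assms by (intro continuous_intros) (auto simp: circle_lift_def intro: degree_one_cont)
  moreover have "\<exists>e>0. \<forall>y. y \<in> UNIV \<and> d y \<noteq> d x \<longrightarrow> e \<le> norm (d y - d x)" for x
  proof (intro exI[of _ 1] conjI allI impI)
    fix y assume "y \<in> UNIV \<and> d y \<noteq> d x"
    then show "1 \<le> norm (d y - d x)" using int Ints_nonzero_abs_ge1[of "d y - d x"] by simp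
  qed simp
  ultimately have "d constant_on UNIV"
    by (intro continuous_discrete_range_constant) auto
  then obtain c where c: "\<And>x. d x = c" by (auto simp: constant_on_def)
  then obtain k :: int where "c = of_int k" using int[of 0] by (auto elim: Ints_cases)
  then have "F x = G x + of_int k * (2 * pi)" for x
    using c[of x] by (simp add: d_def field_simps)
  then show ?thesis by (rule that)
qed

lemma cube_has_fixed_lift:
  assumes u: "u \<in> carrier HomeoPlus_S1" and h: "h \<in> carrier HomeoPlus_S1"
    and rel: "h \<otimes>\<^bsub>HomeoPlus_S1\<^esub> u = (u [^]\<^bsub>HomeoPlus_S1\<^esub> (4::nat)) \<otimes>\<^bsub>HomeoPlus_S1\<^esub> h"
  obtains E e where "circle_lift (u [^]\<^bsub>HomeoPlus_S1\<^esub> (3::nat)) E" "E e = e"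
proof -
  interpret group HomeoPlus_S1 by (rule group_HomeoPlus_S1)
  obtain F H where F: "circle_lift u F" and H: "circle_lift h H"
    using circle_lift_exists u h by metis
  have F2: "circle_lift (u \<otimes>\<^bsub>HomeoPlus_S1\<^esub> u) (F \<circ> F)" by (rule circle_lift_mult[OF u u F F])
  have F3: "circle_lift (u \<otimes>\<^bsub>HomeoPlus_S1\<^esub> u \<otimes>\<^bsub>HomeoPlus_S1\<^esub> u) (F \<circ> F \<circ> F)"
    by (rule circle_lift_mult[OF _ u F2 F]) (use u in simp)
  have F4: "circle_lift (u \<otimes>\<^bsub>HomeoPlus_S1\<^esub> u \<otimes>\<^bsub>HomeoPlus_S1\<^esub> u \<otimes>\<^bsub>HomeoPlus_S1\<^esub> u) (F \<circ> F \<circ> F \<circ> F)"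
    by (rule circle_lift_mult[OF _ u F3 F]) (use u in simp)
  have p3: "u [^]\<^bsub>HomeoPlus_S1\<^esub> (3::nat) = u \<otimes>\<^bsub>HomeoPlus_S1\<^esub> u \<otimes>\<^bsub>HomeoPlus_S1\<^esub> u"
    and p4: "u [^]\<^bsub>HomeoPlus_S1\<^esub> (4::nat) = u \<otimes>\<^bsub>HomeoPlus_S1\<^esub> u \<otimes>\<^bsub>HomeoPlus_S1\<^esub> u \<otimes>\<^bsub>HomeoPlus_S1\<^esub> u"
    using u by (simp_all add: eval_nat_numeral nat_pow_Suc)
  have "circle_lift (h \<otimes>\<^bsub>HomeoPlus_S1\<^esub> u) (H \<circ> F)" by (rule circle_lift_mult[OF h u H F])
  moreover have "circle_lift (h \<otimes>\<^bsub>HomeoPlus_S1\<^esub> u) (F \<circ> F \<circ> F \<circ> F \<circ> H)"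
    unfolding rel p4 by (rule circle_lift_mult[OF _ h F4 H]) (use u in simp)
  ultimately obtain k :: int where
    k: "\<And>x. (H \<circ> F) x = (F \<circ> F \<circ> F \<circ> F \<circ> H) x + of_int k * (2 * pi)"
    by (rule circle_lift_unique) blast
  \<comment> \<open>Write \<open>k\<close> for the error in lifting the relation. Shifting a lift by
    j periods changes its error by j - 4 j = -3 j. The error for \<open>F\<close> is
    \<open>k\<close>, which need not be divisible by 3; for the cube it is 3 \<open>k\<close>, and j
    = \<open>k\<close> cancels it.\<close>
  define E where "E x = F (F (F x)) + of_int k * (2 * pi)" for x
  have d: "degree_one (2 * pi) F" "degree_one (2 * pi) H" using F H by (auto simp: circle_lift_def)
  note sh = degree_one_int[OF d(1)] degree_one_int[OF d(2)]
  have E: "degree_one (2 * pi) E"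
    unfolding E_def using degree_one_comp[OF d(1) degree_one_comp[OF d(1) d(1)]]
    by (intro degree_one_shift) (simp add: o_def)
  have "H (E x) = E (E (E (E (H x))))" for x
  proof -
    have HF: "H (F y) = F (F (F (F (H y)))) + of_int k * (2 * pi)" for y using k[of y] by simp
    show ?thesis unfolding E_def by (simp only: sh HF)
  qed
  then obtain e where e: "E e = e"
    using quadrupled_has_fixpoint[OF E d(2)] by auto
  moreover have "circle_lift (u [^]\<^bsub>HomeoPlus_S1\<^esub> (3::nat)) E"
    using F3 E unfolding p3 circle_lift_def E_def
    by (simp add: cis_shift)
  ultimately show ?thesis using that by blast
qed

text \<open>The relation on the circle gives commutation up to a multiple of 2 pi, and the fixed
  point of \<open>G\<close> leaves no room for that multiple.\<close>

lemma commuting_fixed_lifts: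
  assumes f: "f \<in> carrier HomeoPlus_S1" "circle_lift f F" "F p = p"
    and g: "g \<in> carrier HomeoPlus_S1" "circle_lift g G" "G q = q"
    and com: "f \<otimes>\<^bsub>HomeoPlus_S1\<^esub> g = g \<otimes>\<^bsub>HomeoPlus_S1\<^esub> f"
  shows "F (G x) = G (F x)"
proof (rule intertwine_of_mod_period[where P = "2 * pi" and U = G and W = G])
  show "\<exists>k::int. F (G y) = G (F y) + of_int k * (2 * pi)" for y
    using circle_lift_mult[OF f(1) g(1) f(2) g(2)] circle_lift_mult[OF g(1) f(1) g(2) f(2)] com
    by (intro cis_eq_imp) (auto simp: circle_lift_def)
qed (use f g in \<open>auto simp: circle_lift_def\<close>)

lemma common_fixpoint_dichotomy:
  assumes carr: "{a, b, c, d} \<subseteq> carrier HomeoPlus_S1"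
    and fix_lift: "\<And>f. f \<in> {a, b, c, d} \<Longrightarrow> \<exists>F p. circle_lift f F \<and> F p = p"
    and com: "\<And>f g. f \<in> {a, b} \<Longrightarrow> g \<in> {c, d} \<Longrightarrow>
      g \<otimes>\<^bsub>HomeoPlus_S1\<^esub> f = f \<otimes>\<^bsub>HomeoPlus_S1\<^esub> g"
  shows "(\<exists>q\<in>S1. a q = q \<and> b q = q) \<or> (\<exists>q\<in>S1. c q = q \<and> d q = q)"
proof -
  obtain A B C D p q r s where L: "circle_lift a A" "A p = p" "circle_lift b B" "B q = q"
      "circle_lift c C" "C r = r" "circle_lift d D" "D s = s"
    using fix_lift by (metis insertCI)
  have cf: "C (A x) = A (C x)" "C (B x) = B (C x)" "D (A x) = A (D x)" "D (B x) = B (D x)" for x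
    using carr com
    by (auto intro!: commuting_fixed_lifts[OF _ L(5,6) _ L(1,2)] commuting_fixed_lifts[OF _ L(5,6) _ L(3,4)]
        commuting_fixed_lifts[OF _ L(7,8) _ L(1,2)] commuting_fixed_lifts[OF _ L(7,8) _ L(3,4)])
  have dg: "degree_one (2*pi) A" "degree_one (2*pi) B" "degree_one (2*pi) C" "degree_one (2*pi) D"
    using L by (auto simp: circle_lift_def)
  have pt: "f (cis x) = cis x" if "circle_lift f F" "F x = x" for f F x
    using that by (simp add: circle_lift_def)
  show ?thesis
  proof (cases "\<exists>x. A x = x \<and> B x = x")
    case True
    then obtain x where "A x = x" "B x = x" by blast
    then have "a (cis x) = cis x" "b (cis x) = cis x" using pt L by auto
    then show ?thesis by (metis mem_sphere_0 norm_cis)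
  next
    case False
    then have no: "\<And>x. \<not> (A x = x \<and> B x = x)" by blast
    obtain x where x: "\<And>C c. degree_one (2 * pi) C \<Longrightarrow> C c = c \<Longrightarrow> (\<And>x. C (A x) = A (C x)) \<Longrightarrow>
     (\<And>x. C (B x) = B (C x)) \<Longrightarrow> C x = x"
      using fixpoint_dichotomy[OF _ dg(1) L(2) dg(2) L(4) no] by (metis pi_gt_zero zero_less_mult_iff zero_less_numeral)
    have "C x = x" "D x = x" using x dg L cf by metis+
    then have "c (cis x) = cis x" "d (cis x) = cis x" using pt L by auto
    then show ?thesis by (metis mem_sphere_0 norm_cis)
  qed
qed


section \<open>Order automorphisms of the line acting on half circles\<close>

text \<open>Continuity is automatic: an increasing map can only jump, and a jump would leave a hole
  in its range. Surjectivity is easier to carry through compositions and inverses.\<close>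

definition order_aut :: "(real \<Rightarrow> real) monoid" where
  "order_aut = \<lparr>carrier = {g. strict_mono g \<and> surj g}, mult = (\<circ>), one = id\<rparr>"

lemma order_aut_simps [simp]:
  "g \<in> carrier order_aut \<longleftrightarrow> strict_mono g \<and> surj g"
  "g \<otimes>\<^bsub>order_aut\<^esub> h = g \<circ> h" "\<one>\<^bsub>order_aut\<^esub> = id"
  by (simp_all add: order_aut_def)

lemma group_order_aut: "group order_aut"
proof (rule groupI)
  fix g assume g: "g \<in> carrier order_aut"
  then have fi: "g (inv_into UNIV g x) = x" for x by (simp add: surj_f_inv_f)
  have fi': "inv_into UNIV g (g x) = x" for x using g by (simp add: strict_mono_imp_inj_on)
  have "strict_mono (inv_into UNIV g)"
    unfolding strict_mono_def using fi g by (metis order_aut_simps(1) strict_mono_less)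
  moreover have "surj (inv_into UNIV g)" using fi' by (rule surjI)
  ultimately show "\<exists>h\<in>carrier order_aut. h \<otimes>\<^bsub>order_aut\<^esub> g = \<one>\<^bsub>order_aut\<^esub>"
    using fi' by (intro bexI[of _ "inv_into UNIV g"]) auto
next
  fix g h assume "g \<in> carrier order_aut" "h \<in> carrier order_aut"
  then show "g \<otimes>\<^bsub>order_aut\<^esub> h \<in> carrier order_aut"
    using strict_mono_o[of g h] comp_surj[of h g] by simp
qed (auto simp: strict_mono_def o_assoc)

text \<open>The zeros of \<open>cos\<close> cut the line into cells of length pi, numbered by
  \<open>round (t / pi)\<close> and identified with the whole line by \<open>tan\<close>. A copy of
  \<open>g\<close> acts in each cell whose number lies in \<open>A\<close>; all else, including the
  endpoints of cells, is fixed. Sets \<open>A\<close> and \<open>B\<close> without common elements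
  thus give disjoint supports.\<close>

definition bump :: "int set \<Rightarrow> (real \<Rightarrow> real) \<Rightarrow> real \<Rightarrow> real" where
  "bump A g t = (if cos t \<noteq> 0 \<and> round (t / pi) \<in> A
     then of_int (round (t / pi)) * pi + arctan (g (tan t)) else t)"

lemma sin_int_pi: "sin (of_int n * pi) = 0"
  using sin_zero_iff_int2 by blast

lemma cos_int_pi_ne_0: "cos (of_int n * pi) \<noteq> 0"
  using sin_cos_squared_add[of "of_int n * pi"] sin_int_pi[of n] by force

lemma cos_int_pi_add: "cos (of_int n * pi + y) = cos (of_int n * pi) * cos y"
  by (simp add: cos_add sin_int_pi)

lemma real_cell_cases:
  obtains "cos t = 0" | n :: int and x where "t = of_int n * pi + arctan x"
proof (cases "cos t = 0")
  case False
  define n where "n = round (t / pi)"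
  define y where "y = t - of_int n * pi"
  have "\<bar>of_int n - t / pi\<bar> \<le> 1/2" unfolding n_def by (rule of_int_round_abs_le)
  then have "\<bar>of_int n - t / pi\<bar> * pi \<le> 1/2 * pi" by (intro mult_right_mono) auto
  also have "\<bar>of_int n - t / pi\<bar> * pi = \<bar>(of_int n - t / pi) * pi\<bar>" by (simp add: abs_mult)
  also have "(of_int n - t / pi) * pi = - y" by (simp add: y_def algebra_simps)
  finally have "\<bar>y\<bar> \<le> pi / 2" by simp
  moreover have "cos t = cos (of_int n * pi) * cos y"
    using cos_int_pi_add[of n y] by (simp add: y_def)
  then have "cos y \<noteq> 0" using False by auto
  then have "y \<noteq> pi/2" "y \<noteq> -(pi/2)" using cos_pi_half cos_minus[of "pi/2"] by metis+
  ultimately have "arctan (tan y) = y" by (intro arctan_tan) auto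
  then have "t = of_int n * pi + arctan (tan y)" by (simp add: y_def)
  with that(2) show ?thesis by blast
qed (use that in blast)

lemma cell_props:
  shows "cos (of_int n * pi + arctan x) \<noteq> 0" "round ((of_int n * pi + arctan x) / pi) = n"
    "tan (of_int n * pi + arctan x) = x"
proof -
  show "cos (of_int n * pi + arctan x) \<noteq> 0"
    using cos_int_pi_ne_0[of n] by (simp add: cos_int_pi_add)
  have "\<bar>arctan x\<bar> < pi / 2" using arctan_bounded[of x] by linarith
  then have "\<bar>(of_int n * pi + arctan x) / pi - of_int n\<bar> < 1/2"
    by (simp add: add_divide_distrib divide_less_eq)
  then show "round ((of_int n * pi + arctan x) / pi) = n" by (rule round_unique')
  show "tan (of_int n * pi + arctan x) = x"
    using tan_periodic_int[of "arctan x" n] by (simp add: add.commute tan_arctan)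
qed

lemma bump_cell:
  "bump A g (of_int n * pi + arctan x) = of_int n * pi + arctan (if n \<in> A then g x else x)"
  unfolding bump_def cell_props by (simp add: cell_props(1))

lemma bump_node: "cos t = 0 \<Longrightarrow> bump A g t = t"
  by (simp add: bump_def)

lemma bump_id: "bump A id t = t"
  by (rule real_cell_cases[of t]) (auto simp: bump_node bump_cell)

lemma bump_comp: "bump A (g \<circ> h) t = bump A g (bump A h t)"
  by (rule real_cell_cases[of t]) (auto simp: bump_node bump_cell)

lemma bump_commute:
  assumes "A \<inter> B = {}" shows "bump A g (bump B h t) = bump B h (bump A g t)"
  using assms by (cases t rule: real_cell_cases) (auto simp: bump_node bump_cell)

lemma bump_shift:
  assumes "\<And>n. n + k \<in> A \<longleftrightarrow> n \<in> A"
  shows "bump A g (t + of_int k * pi) = bump A g t + of_int k * pi"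
proof (cases t rule: real_cell_cases)
  case 1
  then have "cos (t + of_int k * pi) = 0" by (simp add: cos_add sin_int_pi)
  then show ?thesis using 1 by (simp add: bump_node)
next
  case (2 n x)
  have s: "t + of_int k * pi = of_int (n + k) * pi + arctan x" by (simp add: 2 algebra_simps)
  show ?thesis unfolding s unfolding 2 bump_cell assms by (simp add: algebra_simps)
qed

lemma node_off_cell:
  assumes "cos t = 0"
  shows "t \<le> of_int n * pi - pi/2 \<or> of_int n * pi + pi/2 \<le> t"
proof (rule ccontr)
  assume "\<not> ?thesis"
  then have "cos (t - of_int n * pi) > 0" by (intro cos_gt_zero_pi) auto
  then show False using assms by (simp add: cos_diff sin_int_pi)
qed

lemma cells_ordered:
  fixes m n :: int
  assumes "m < n" shows "of_int m * pi + pi/2 \<le> of_int n * pi - pi/2"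
proof -
  have "of_int (m + 1) * pi \<le> of_int n * pi" using assms by (intro mult_right_mono) auto
  then show ?thesis by (simp add: algebra_simps)
qed

lemma bump_strict_mono:
  assumes "strict_mono g" shows "strict_mono (bump A g)"
proof (rule strict_monoI)
  fix s t :: real assume st: "s < t"
  note ab = arctan_bounded
  show "bump A g s < bump A g t"
  proof (cases s rule: real_cell_cases)
    case 1
    show ?thesis
    proof (cases t rule: real_cell_cases)
      case (2 n x)
      then show ?thesis using st 1 node_off_cell[OF 1, of n] ab[of x] ab[of "if n \<in> A then g x else x"]
        unfolding 2 bump_cell bump_node[OF 1] by linarith
    qed (use 1 st in \<open>simp add: bump_node\<close>)
  next
    case s: (2 m x)
    show ?thesis
    proof (cases t rule: real_cell_cases)
      case 1
      show ?thesis using st node_off_cell[OF 1, of m] ab[of x] ab[of "if m \<in> A then g x else x"]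
        unfolding s bump_cell bump_node[OF 1] by linarith
    next
      case t: (2 n y)
      have "m \<le> n"
        using st cells_ordered[of n m] ab[of x] ab[of y] unfolding s t by force
      then consider "m < n" | "m = n" by linarith
      then show ?thesis
      proof cases
        case 1
        then show ?thesis
          using cells_ordered[of m n] ab[of "if m \<in> A then g x else x"] ab[of "if n \<in> A then g y else y"]
          unfolding s t bump_cell by linarith
      next
        case 2
        then have "x < y" using st unfolding s t by (simp add: arctan_less_iff)
        then show ?thesis using 2 assms unfolding s t bump_cell
          by (simp add: arctan_less_iff strict_mono_less)
      qed
    qed
  qed
qed

lemma bump_hom: "bump A \<in> hom order_aut order_aut"
proof (rule homI)
  fix g assume g: "g \<in> carrier order_aut"
  interpret group order_aut by (rule group_order_aut)
  have "g \<circ> m_inv order_aut g = id" using r_inv[OF g] by simp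
  then have "bump A g (bump A (m_inv order_aut g) t) = t" for t
    by (simp add: bump_comp[symmetric] bump_id)
  then have "surj (bump A g)" by (rule surjI)
  then show "bump A g \<in> carrier order_aut" using g bump_strict_mono by simp
qed (auto simp: bump_comp fun_eq_iff)

lemma bump_degree_one:
  assumes g: "g \<in> carrier order_aut" and A: "\<And>n. n + k \<in> A \<longleftrightarrow> n \<in> A"
  shows "degree_one (of_int k * pi) (bump A g)"
  using hom_in_carrier[OF bump_hom[of A] g] bump_shift[OF A]
  by (auto simp: degree_one_def intro: strict_mono_surj_continuous)

section \<open>From maps of the line to maps of half circles\<close>

definition circle_map :: "(real \<Rightarrow> real) \<Rightarrow> complex \<Rightarrow> complex" where
  "circle_map F = (\<lambda>z\<in>S1. cis (F (Arg z)))"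

lemma circle_lift_circle_map:
  assumes "degree_one (2 * pi) F" shows "circle_lift (circle_map F) F"
proof -
  have "circle_map F (cis t) = cis (F t)" for t
  proof -
    have "cis (Arg (cis t)) = cis t" by (rule circle_cis) simp
    then obtain k :: int where k: "Arg (cis t) = t + of_int k * (2 * pi)" using cis_eq_imp by blast
    show ?thesis by (simp add: circle_map_def k degree_one_int[OF assms] cis_shift)
  qed
  then show ?thesis using assms by (simp add: circle_lift_def)
qed

lemma circle_map_closed:
  "degree_one (2 * pi) F \<Longrightarrow> circle_map F \<in> carrier HomeoPlus_S1"
  by (rule HomeoPlus_S1_of_lift[OF _ circle_lift_circle_map]) (auto simp: circle_map_def)

lemma circle_map_mult:
  assumes "degree_one (2 * pi) F" "degree_one (2 * pi) G"
  shows "circle_map F \<otimes>\<^bsub>HomeoPlus_S1\<^esub> circle_map G = circle_map (F \<circ> G)"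
proof -
  have "circle_map F (cis t) = cis (F t)" for t
    using circle_lift_circle_map[OF assms(1)] by (simp add: circle_lift_def)
  then show ?thesis
    using assms by (simp add: mult_HomeoPlus_S1 circle_map_closed)
      (auto simp: fun_eq_iff compose_def circle_map_def)
qed

text \<open>Even cells make up the open right half of the circle, odd cells the left half.\<close>
definition half_circle_map :: "bool \<Rightarrow> (real \<Rightarrow> real) \<Rightarrow> complex \<Rightarrow> complex" where
  "half_circle_map b g = circle_map (bump {n. even n = b} g)"

lemma half_degree_one:
  "g \<in> carrier order_aut \<Longrightarrow> degree_one (2 * pi) (bump {n. even n = b} g)"
  using bump_degree_one[of g 2 "{n. even n = b}"] by simp

lemma half_circle_map_hom: "half_circle_map b \<in> hom order_aut HomeoPlus_S1"
proof (rule homI)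
  fix g assume "g \<in> carrier order_aut"
  then show "half_circle_map b g \<in> carrier HomeoPlus_S1"
    unfolding half_circle_map_def by (intro circle_map_closed half_degree_one)
next
  fix g h assume gh: "g \<in> carrier order_aut" "h \<in> carrier order_aut"
  have "half_circle_map b g \<otimes>\<^bsub>HomeoPlus_S1\<^esub> half_circle_map b h =
    circle_map (bump {n. even n = b} g \<circ> bump {n. even n = b} h)"
    unfolding half_circle_map_def using gh by (intro circle_map_mult half_degree_one)
  also have "bump {n. even n = b} g \<circ> bump {n. even n = b} h = bump {n. even n = b} (g \<circ> h)"
    by (simp add: fun_eq_iff bump_comp[symmetric])
  finally show "half_circle_map b (g \<otimes>\<^bsub>order_aut\<^esub> h) =
      half_circle_map b g \<otimes>\<^bsub>HomeoPlus_S1\<^esub> half_circle_map b h"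
    by (simp add: half_circle_map_def)
qed

lemma half_circle_map_commute:
  assumes "g \<in> carrier order_aut" "h \<in> carrier order_aut" "b \<noteq> c"
  shows "half_circle_map b g \<otimes>\<^bsub>HomeoPlus_S1\<^esub> half_circle_map c h =
    half_circle_map c h \<otimes>\<^bsub>HomeoPlus_S1\<^esub> half_circle_map b g"
proof -
  have "bump {n. even n = b} g \<circ> bump {n. even n = c} h =
    bump {n. even n = c} h \<circ> bump {n. even n = b} g"
    using assms(3) by (auto simp: fun_eq_iff intro!: bump_commute)
  then show ?thesis unfolding half_circle_map_def
    using assms by (simp add: circle_map_mult half_degree_one del: order_aut_simps)
qed

lemma half_circle_map_nontrivial:
  assumes g: "g \<in> carrier order_aut" and x: "g x \<noteq> x"
  shows "half_circle_map b g \<noteq> \<one>\<^bsub>HomeoPlus_S1\<^esub>"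
proof
  assume eq: "half_circle_map b g = \<one>\<^bsub>HomeoPlus_S1\<^esub>"
  \<comment> \<open>A cell of the parity in which \<open>g\<close> acts.\<close>
  define n :: int where "n = (if b then 0 else 1)"
  define t where "t = of_int n * pi + arctan x"
  have "cis (bump {n. even n = b} g t) = half_circle_map b g (cis t)"
    using circle_lift_circle_map[OF half_degree_one[OF g]]
    by (simp add: half_circle_map_def circle_lift_def)
  also have "\<dots> = cis t" by (simp add: eq one_HomeoPlus_S1)
  finally obtain k :: int where "bump {n. even n = b} g t = t + of_int k * (2 * pi)"
    using cis_eq_imp by blast
  then have k: "arctan (g x) = arctan x + of_int k * (2 * pi)"
    unfolding t_def bump_cell by (simp add: n_def split: if_splits)
  then have "\<bar>of_int k * (2 * pi)\<bar> < 2 * pi"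
    using arctan_bounded[of x] arctan_bounded[of "g x"] by linarith
  then have "k = 0" by (intro int_multiple_small[of "2 * pi"]) auto
  then have "arctan (g x) = arctan x" using k by simp
  then show False using x by (simp add: arctan_eq_iff)
qed


section \<open>Lifts of shear matrices\<close>

text \<open>Lifts to the angular coordinate of the projective action of a 2x2 matrix on lines in the plane.\<close>
definition projective_lift :: "(real \<Rightarrow> real) \<Rightarrow> real \<Rightarrow> real \<Rightarrow> real \<Rightarrow> real \<Rightarrow> bool" where
  "projective_lift F a b c d \<longleftrightarrow> (\<forall>t. \<exists>r. r \<noteq> 0 \<and>
     a * cos t + b * sin t = r * cos (F t) \<and> c * cos t + d * sin t = r * sin (F t))"

lemma projective_lift_comp:
  assumes F: "projective_lift F a b c d" and G: "projective_lift G a' b' c' d'"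
  shows "projective_lift (F \<circ> G) (a * a' + b * c') (a * b' + b * d') (c * a' + d * c') (c * b' + d * d')"
  unfolding projective_lift_def
proof
  fix t
  obtain r where r: "r \<noteq> 0" "a' * cos t + b' * sin t = r * cos (G t)" "c' * cos t + d' * sin t = r * sin (G t)"
    using G unfolding projective_lift_def by blast
  obtain s where s: "s \<noteq> 0" "a * cos (G t) + b * sin (G t) = s * cos (F (G t))"
      "c * cos (G t) + d * sin (G t) = s * sin (F (G t))"
    using F unfolding projective_lift_def by blast
  have "(a * a' + b * c') * cos t + (a * b' + b * d') * sin t =
      a * (a' * cos t + b' * sin t) + b * (c' * cos t + d' * sin t)" by (simp add: algebra_simps)
  also have "\<dots> = r * (a * cos (G t) + b * sin (G t))" unfolding r by (simp add: algebra_simps)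
  finally have 1: "(a * a' + b * c') * cos t + (a * b' + b * d') * sin t = s * r * cos (F (G t))"
    unfolding s by simp
  have "(c * a' + d * c') * cos t + (c * b' + d * d') * sin t =
      c * (a' * cos t + b' * sin t) + d * (c' * cos t + d' * sin t)" by (simp add: algebra_simps)
  also have "\<dots> = r * (c * cos (G t) + d * sin (G t))" unfolding r by (simp add: algebra_simps)
  finally have 2: "(c * a' + d * c') * cos t + (c * b' + d * d') * sin t = s * r * sin (F (G t))"
    unfolding s by simp
  show "\<exists>r. r \<noteq> 0 \<and> (a * a' + b * c') * cos t + (a * b' + b * d') * sin t = r * cos ((F \<circ> G) t) \<and>
     (c * a' + d * c') * cos t + (c * b' + d * d') * sin t = r * sin ((F \<circ> G) t)"
    using 1 2 r(1) s(1) by (intro exI[of _ "s * r"]) simp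
qed

lemma projective_lift_unique:
  assumes "projective_lift F a b c d" "projective_lift G a b c d"
  shows "\<exists>k::int. F t = G t + of_int k * pi"
proof -
  obtain r where r: "r \<noteq> 0" "a * cos t + b * sin t = r * cos (F t)" "c * cos t + d * sin t = r * sin (F t)"
    using assms(1) unfolding projective_lift_def by blast
  obtain s where s: "s \<noteq> 0" "a * cos t + b * sin t = s * cos (G t)" "c * cos t + d * sin t = s * sin (G t)"
    using assms(2) unfolding projective_lift_def by blast
  \<comment> \<open>This is the determinant of the two image vectors, which are the same vector
    because both maps lift the same matrix.\<close>
  have "r * s * sin (F t - G t) = (r * sin (F t)) * (s * cos (G t)) - (r * cos (F t)) * (s * sin (G t))"
    by (simp add: sin_diff algebra_simps)
  also have "\<dots> = 0" unfolding r(2,3)[symmetric] s(2,3)[symmetric] by simp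
  finally have "sin (F t - G t) = 0" using r s by simp
  then obtain k :: int where "F t - G t = of_int k * pi" using sin_zero_iff_int2 by blast
  then show ?thesis by (intro exI[of _ k]) simp
qed

text \<open>The matrix (1 0; x 1) adds \<open>x\<close> to the slope of a line, and
  \<open>tan\<close> turns the angle into the slope. Every cell of \<open>bump\<close> is used,
  since all of them represent the same lines; the endpoints represent the vertical line, which is
  fixed.\<close>

definition lower_shear :: "real \<Rightarrow> real \<Rightarrow> real" where
  "lower_shear x = bump UNIV (\<lambda>t. t + x)"

text \<open>A quarter turn conjugates (1 0; -x 1) into (1 x; 0 1).\<close>

definition upper_shear :: "real \<Rightarrow> real \<Rightarrow> real" where
  "upper_shear x t = lower_shear (- x) (t - pi/2) + pi/2"

lemma lower_shear_carrier: "lower_shear x \<in> carrier order_aut"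
proof -
  have "(\<lambda>t. t + x) \<in> carrier order_aut"
    by (auto simp: strict_mono_def intro: surjI[of _ "\<lambda>t. t - x"])
  then show ?thesis unfolding lower_shear_def by (rule hom_in_carrier[OF bump_hom])
qed

lemma lower_shear_degree_one: "degree_one pi (lower_shear x)"
proof -
  have "(\<lambda>t. t + x) \<in> carrier order_aut"
    by (auto simp: strict_mono_def intro: surjI[of _ "\<lambda>t. t - x"])
  then show ?thesis using bump_degree_one[of _ 1 UNIV] by (simp add: lower_shear_def)
qed

lemma lower_shear_add: "lower_shear x (lower_shear y t) = lower_shear (x + y) t"
  unfolding lower_shear_def bump_comp[symmetric] by (simp add: o_def add_ac)

lemma lower_shear_0: "lower_shear 0 t = t"
  using bump_id[of UNIV t] by (simp add: lower_shear_def id_def)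

lemma lower_shear_fix: "lower_shear x (pi/2) = pi/2"
  by (simp add: lower_shear_def bump_node)

lemma lower_shear_lift: "projective_lift (lower_shear x) 1 0 x 1"
  unfolding projective_lift_def
proof
  fix t
  show "\<exists>r. r \<noteq> 0 \<and> 1 * cos t + 0 * sin t = r * cos (lower_shear x t) \<and>
      x * cos t + 1 * sin t = r * sin (lower_shear x t)"
  proof (cases t rule: real_cell_cases)
    case 1
    then show ?thesis by (intro exI[of _ 1]) (simp add: lower_shear_def bump_node)
  next
    case (2 n y)
    define e where "e = cos (of_int n * pi)"
    have sc: "cos (of_int n * pi + arctan z) = e * cos (arctan z)"
      "sin (of_int n * pi + arctan z) = e * (z * cos (arctan z))" for z
      using tan_arctan[of z] cos_arctan_not_zero[of z]
      by (simp_all add: cos_add sin_add sin_int_pi e_def tan_def field_simps)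
    have ls: "lower_shear x t = of_int n * pi + arctan (y + x)"
      unfolding lower_shear_def 2 bump_cell by simp
    show ?thesis unfolding ls unfolding 2 sc
      using cos_arctan_not_zero[of y] cos_arctan_not_zero[of "y + x"]
      by (intro exI[of _ "cos (arctan y) / cos (arctan (y + x))"]) (simp add: field_simps)
  qed
qed

lemma upper_shear_degree_one: "degree_one pi (upper_shear x)"
proof -
  have "continuous_on UNIV (\<lambda>t. lower_shear (- x) (t - pi/2))"
    using degree_one_cont[OF lower_shear_degree_one[of "-x"], of UNIV]
    by (rule continuous_on_compose2) (auto intro!: continuous_intros)
  moreover have "lower_shear (- x) (t + pi - pi/2) = lower_shear (- x) (t - pi/2) + pi" for t
    using lower_shear_degree_one[of "-x"] by (metis (no_types) add_diff_eq add.commute degree_one_def diff_add_eq)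
  ultimately show ?thesis
    unfolding degree_one_def upper_shear_def using lower_shear_degree_one[of "-x"]
    by (auto simp: strict_mono_def degree_one_def intro!: continuous_intros)
qed

lemma upper_shear_carrier: "upper_shear x \<in> carrier order_aut"
  using degree_one_surj[OF upper_shear_degree_one] upper_shear_degree_one[of x]
  by (simp add: degree_one_def)

lemma upper_shear_add: "upper_shear x (upper_shear y t) = upper_shear (x + y) t"
  by (simp add: upper_shear_def lower_shear_add)

lemma upper_shear_0: "upper_shear 0 t = t"
  by (simp add: upper_shear_def lower_shear_0)

lemma upper_shear_fix: "upper_shear x pi = pi"
  using lower_shear_fix[of "-x"] by (simp add: upper_shear_def)

lemma upper_shear_lift: "projective_lift (upper_shear x) 1 x 0 1"
  unfolding projective_lift_def
proof
  fix t
  obtain r where r: "r \<noteq> 0"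
    "1 * cos (t - pi/2) + 0 * sin (t - pi/2) = r * cos (lower_shear (- x) (t - pi/2))"
    "- x * cos (t - pi/2) + 1 * sin (t - pi/2) = r * sin (lower_shear (- x) (t - pi/2))"
    using lower_shear_lift[of "-x"] unfolding projective_lift_def by blast
  then show "\<exists>r. r \<noteq> 0 \<and> 1 * cos t + x * sin t = r * cos (upper_shear x t) \<and>
      0 * cos t + 1 * sin t = r * sin (upper_shear x t)"
    by (intro exI[of _ r]) (simp add: upper_shear_def cos_add sin_add cos_diff sin_diff algebra_simps)
qed

lemma lower_shear_group:
  "lower_shear x \<otimes>\<^bsub>order_aut\<^esub> lower_shear y = lower_shear (x + y)"
  "lower_shear x [^]\<^bsub>order_aut\<^esub> (n::nat) = lower_shear (of_nat n * x)"
  "inv\<^bsub>order_aut\<^esub> (lower_shear x) = lower_shear (- x)"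
proof -
  interpret group order_aut by (rule group_order_aut)
  show m: "lower_shear x \<otimes>\<^bsub>order_aut\<^esub> lower_shear y = lower_shear (x + y)" for x y
    by (simp add: fun_eq_iff lower_shear_add)
  have z: "lower_shear 0 = \<one>\<^bsub>order_aut\<^esub>" by (simp add: fun_eq_iff lower_shear_0)
  show "lower_shear x [^]\<^bsub>order_aut\<^esub> (n::nat) = lower_shear (of_nat n * x)"
    by (induction n) (simp_all add: z m algebra_simps del: order_aut_simps)
  show "inv\<^bsub>order_aut\<^esub> (lower_shear x) = lower_shear (- x)"
    using z by (intro inv_equality) (simp_all add: m lower_shear_carrier del: order_aut_simps)
qed

lemma upper_shear_group:
  "upper_shear x \<otimes>\<^bsub>order_aut\<^esub> upper_shear y = upper_shear (x + y)"
  "upper_shear x [^]\<^bsub>order_aut\<^esub> (n::nat) = upper_shear (of_nat n * x)"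
  "inv\<^bsub>order_aut\<^esub> (upper_shear x) = upper_shear (- x)"
proof -
  interpret group order_aut by (rule group_order_aut)
  show m: "upper_shear x \<otimes>\<^bsub>order_aut\<^esub> upper_shear y = upper_shear (x + y)" for x y
    by (simp add: fun_eq_iff upper_shear_add)
  have z: "upper_shear 0 = \<one>\<^bsub>order_aut\<^esub>" by (simp add: fun_eq_iff upper_shear_0)
  show "upper_shear x [^]\<^bsub>order_aut\<^esub> (n::nat) = upper_shear (of_nat n * x)"
    by (induction n) (simp_all add: z m algebra_simps del: order_aut_simps)
  show "inv\<^bsub>order_aut\<^esub> (upper_shear x) = upper_shear (- x)"
    using z by (intro inv_equality) (simp_all add: m upper_shear_carrier del: order_aut_simps)
qed

text \<open>In the matrix group, \<^term>\<open>a\<close> = (1 3; 0 1) and \<^term>\<open>b\<close> = (1 0; 1/6 1) give the diagonal matrix (2, 1/2).\<close>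
definition torus_word :: "('a, 'b) monoid_scheme \<Rightarrow> 'a \<Rightarrow> 'a \<Rightarrow> 'a" where
  "torus_word G a b = a \<otimes>\<^bsub>G\<^esub> (a \<otimes>\<^bsub>G\<^esub> (inv\<^bsub>G\<^esub> b \<otimes>\<^bsub>G\<^esub>
     (a \<otimes>\<^bsub>G\<^esub> (b \<otimes>\<^bsub>G\<^esub> (b \<otimes>\<^bsub>G\<^esub> inv\<^bsub>G\<^esub> a)))))"

text \<open>The word is built from the cubes, so that it fixes every common fixed point of theirs,
  while the relations are stated for \<open>u\<close> and \<open>v\<close> themselves, which is what
  lifting the cubes requires. The second relation runs the other way: the inverse of
  \<open>w\<close> is what quadruples \<open>v\<close>.\<close>

definition quadrupling_pair :: "('a, 'b) monoid_scheme \<Rightarrow> 'a \<Rightarrow> 'a \<Rightarrow> bool" where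
  "quadrupling_pair G u v \<longleftrightarrow> u \<in> carrier G \<and> v \<in> carrier G \<and>
     (\<exists>w. w = torus_word G (u [^]\<^bsub>G\<^esub> (3::nat)) (v [^]\<^bsub>G\<^esub> (3::nat)) \<and>
       w \<otimes>\<^bsub>G\<^esub> u = u [^]\<^bsub>G\<^esub> (4::nat) \<otimes>\<^bsub>G\<^esub> w \<and>
       w \<otimes>\<^bsub>G\<^esub> v [^]\<^bsub>G\<^esub> (4::nat) = v \<otimes>\<^bsub>G\<^esub> w)"

text \<open>Both relations hold for matrices, hence for lifts up to multiples of pi. The shear lifts
  have fixed points, which makes the relations exact.\<close>

lemma quadrupling_pair_shears:
  "quadrupling_pair order_aut (upper_shear 1) (lower_shear (1/18))"
proof -
  define w where "w = torus_word order_aut (upper_shear 3) (lower_shear (1/6))"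
  have w: "w = upper_shear 3 \<circ> (upper_shear 3 \<circ> (lower_shear (-(1/6)) \<circ>
     (upper_shear 3 \<circ> (lower_shear (1/6) \<circ> (lower_shear (1/6) \<circ> upper_shear (-3))))))"
    by (simp only: w_def torus_word_def lower_shear_group upper_shear_group order_aut_simps)
  have wd: "degree_one pi w" unfolding w
    by (intro degree_one_comp upper_shear_degree_one lower_shear_degree_one)
  have "projective_lift w 2 0 0 (1/2)"
    using projective_lift_comp[OF upper_shear_lift[of 3] projective_lift_comp[OF upper_shear_lift[of 3]
      projective_lift_comp[OF lower_shear_lift[of "-(1/6)"] projective_lift_comp[OF upper_shear_lift[of 3]
      projective_lift_comp[OF lower_shear_lift[of "1/6"] projective_lift_comp[OF lower_shear_lift[of "1/6"]
      upper_shear_lift[of "-3"]]]]]]]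
    unfolding w by simp
  note wl = projective_lift_comp[OF this] projective_lift_comp[OF _ this]
  have "w (upper_shear 1 t) = upper_shear 4 (w t)" for t
  proof (rule intertwine_of_mod_period[OF wd upper_shear_degree_one upper_shear_fix
        upper_shear_degree_one upper_shear_fix pi_gt_zero])
    show "\<exists>k::int. w (upper_shear 1 x) = upper_shear 4 (w x) + of_int k * pi" for x
      using projective_lift_unique[of "w \<circ> upper_shear 1" 2 2 0 "1/2" "upper_shear 4 \<circ> w" x]
        wl(1)[OF upper_shear_lift[of 1]] wl(2)[OF upper_shear_lift[of 4]] by simp
  qed
  \<comment> \<open>Here 2/9 is four times 1/18: conjugation by the diagonal matrix divides lower
    entries by 4.\<close>
  moreover have "w (lower_shear (2/9) t) = lower_shear (1/18) (w t)" for t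
  proof (rule intertwine_of_mod_period[OF wd lower_shear_degree_one lower_shear_fix
        lower_shear_degree_one lower_shear_fix pi_gt_zero])
    show "\<exists>k::int. w (lower_shear (2/9) x) = lower_shear (1/18) (w x) + of_int k * pi" for x
      using projective_lift_unique[of "w \<circ> lower_shear (2/9)" 2 0 "1/9" "1/2" "lower_shear (1/18) \<circ> w" x]
        wl(1)[OF lower_shear_lift[of "2/9"]] wl(2)[OF lower_shear_lift[of "1/18"]] by simp
  qed
  ultimately show ?thesis
    unfolding quadrupling_pair_def
    by (intro conjI exI[of _ w] upper_shear_carrier lower_shear_carrier)
      (simp_all add: lower_shear_group(2) upper_shear_group(2) w_def[symmetric] fun_eq_iff)
qed


section \<open>Strict derivatives and displacements at a fixed point\<close>

text \<open>Both points move, unlike in the ordinary derivative. Comparing displacements at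
  \<open>z\<close> and at its image under another element needs an estimate between two points near
  \<open>q\<close>, neither of them equal to \<open>q\<close>.\<close>

definition strictly_differentiable :: "complex set \<Rightarrow> complex \<Rightarrow> (complex \<Rightarrow> complex) \<Rightarrow> complex \<Rightarrow> bool" where
  "strictly_differentiable S q f D \<longleftrightarrow> (\<forall>e>0. \<exists>d>0. \<forall>z\<in>S. \<forall>w\<in>S. dist z q < d \<longrightarrow> dist w q < d \<longrightarrow>
     norm (f z - f w - D * (z - w)) \<le> e * norm (z - w))"

lemma strictly_differentiable_imp_derivative:
  assumes f: "strictly_differentiable S q f D" and q: "q \<in> S"
  shows "(f has_field_derivative D) (at q within S)"
  unfolding has_field_derivative_def has_derivative_within_alt
proof (intro conjI allI impI bounded_linear_mult_right)
  fix e :: real assume "0 < e"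
  then obtain d where "d > 0" "\<forall>z\<in>S. \<forall>w\<in>S. dist z q < d \<longrightarrow> dist w q < d \<longrightarrow>
     norm (f z - f w - D * (z - w)) \<le> e * norm (z - w)"
    using f unfolding strictly_differentiable_def by blast
  then show "\<exists>d>0. \<forall>y\<in>S. norm (y - q) < d \<longrightarrow> norm (f y - f q - D * (y - q)) \<le> e * norm (y - q)"
    using q by (intro exI[of _ d]) (auto simp: dist_norm)
qed

text \<open>The derivative of sin x - x/2 is cos x - 1/2, which is nonnegative up to pi/3 >
  1.\<close>

lemma half_le_sin:
  assumes "0 \<le> x" "x \<le> (1::real)" shows "x / 2 \<le> sin x"
proof -
  have "sin 0 - 0 / 2 \<le> sin x - x / 2"
  proof (rule DERIV_nonneg_imp_nondecreasing[OF assms(1)])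
    fix y assume y: "0 \<le> y" "y \<le> x"
    have "cos (pi / 3) \<le> cos y"
      using y assms pi_gt3 by (intro cos_monotone_0_pi_le) auto
    then have "0 \<le> cos y - 1 / 2" by (simp add: cos_60)
    moreover have "((\<lambda>x. sin x - x / 2) has_real_derivative (cos y - 1 / 2)) (at y)"
      by (auto intro!: derivative_eq_intros)
    ultimately show "\<exists>D. ((\<lambda>x. sin x - x / 2) has_real_derivative D) (at y) \<and> 0 \<le> D" by blast
  qed
  then show ?thesis by simp
qed

lemma arc_le_chord:
  assumes "\<bar>s - t\<bar> \<le> 1" shows "\<bar>s - t\<bar> \<le> 2 * norm (cis s - cis t)"
proof -
  have "\<bar>s - t\<bar> / 2 \<le> \<bar>sin (s - t)\<bar>"
    using half_le_sin[of "\<bar>s - t\<bar>"] half_le_sin[of "- (s - t)"] assms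
    unfolding sin_minus by (cases "s \<ge> t") auto
  also have "\<dots> = \<bar>Im (cis (s - t) - 1)\<bar>" by simp
  also have "\<dots> \<le> norm (cis (s - t) - 1)" by (rule abs_Im_le_cmod)
  also have "\<dots> = norm (cis t * (cis (s - t) - 1))" by (simp add: norm_mult)
  also have "cis t * (cis (s - t) - 1) = cis s - cis t"
    by (simp add: right_diff_distrib cis_mult)
  finally show ?thesis by simp
qed

text \<open>The curve \<open>f (cis t)\<close> stays on the circle, so its velocity at the fixed
  point is tangent there, that is, a real multiple \<open>r\<close> of the velocity of
  \<open>cis\<close>. Subtracting \<open>r\<close> times \<open>cis\<close> leaves a function whose
  derivative is continuous and vanishes at that parameter. The mean value inequality makes it
  Lipschitz with a small constant, and chords replace arcs at the cost of a factor 2.\<close>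

lemma C1_circle_strictly_differentiable:
  assumes C1: "C1_on_S1 f" and S: "\<And>z. z \<in> S1 \<Longrightarrow> f z \<in> S1" and q: "q \<in> S1" "f q = q"
  obtains r :: real where "strictly_differentiable S1 q f (of_real r)"
proof -
  define \<phi> where "\<phi> t = f (cis t)" for t
  obtain D where D: "\<And>t. (\<phi> has_vector_derivative D t) (at t)" and cD: "continuous_on UNIV D"
    using C1 unfolding C1_on_S1_def C1_differentiable_on_def \<phi>_def by auto
  define t0 where "t0 = Arg q"
  have t0: "cis t0 = q" "\<phi> t0 = q" using circle_cis[OF q(1)] q(2) by (simp_all add: t0_def \<phi>_def)
  have "((\<lambda>t. \<phi> t \<bullet> \<phi> t) has_vector_derivative (\<phi> t0 \<bullet> D t0 + D t0 \<bullet> \<phi> t0)) (at t0)"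
    by (rule bounded_bilinear.has_vector_derivative[OF bounded_bilinear_inner D D])
  moreover have "\<phi> t \<bullet> \<phi> t = 1" for t
    using S[of "cis t"] by (simp add: \<phi>_def power2_norm_eq_inner[symmetric])
  ultimately have "((\<lambda>t. 1::real) has_vector_derivative (\<phi> t0 \<bullet> D t0 + D t0 \<bullet> \<phi> t0)) (at t0)" by simp
  then have "\<phi> t0 \<bullet> D t0 + D t0 \<bullet> \<phi> t0 = 0"
    by (rule vector_derivative_unique_at) (rule has_vector_derivative_const)
  then have perp: "Re (D t0 * cnj q) = 0"
    by (simp add: t0 inner_complex_def mult.commute)
  define r where "r = Im (D t0 * cnj q)"
  have "q * cnj q = 1" using q by (simp add: complex_norm_square[symmetric])
  then have "D t0 = (D t0 * cnj q) * q" by (simp add: mult.assoc mult.commute[of "cnj q"])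
  also have "D t0 * cnj q = \<i> * of_real r" using perp by (simp add: r_def complex_eq_iff)
  finally have Dr: "D t0 = of_real r * (\<i> * cis t0)" by (simp add: t0)
  define \<psi> where "\<psi> t = \<phi> t - of_real r * cis t" for t
  define E where "E t = D t - of_real r * (\<i> * cis t)" for t
  have dcis: "(cis has_vector_derivative \<i> * cis t) (at t)" for t
    using has_derivative_cis[OF has_derivative_ident, of t UNIV] by (simp add: has_vector_derivative_def)
  have E: "(\<psi> has_vector_derivative E t) (at t)" for t
    unfolding \<psi>_def E_def by (intro derivative_intros D dcis)
  have "continuous_on UNIV E" unfolding E_def by (intro continuous_intros cD)
  then have "isCont E t0" by (simp add: continuous_on_eq_continuous_at)
  have E0: "E t0 = 0" by (simp add: E_def Dr)
  have "strictly_differentiable S1 q f (of_real r)"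
    unfolding strictly_differentiable_def
  proof (intro allI impI)
    fix e :: real assume e: "e > 0"
    obtain \<eta> where \<eta>: "\<eta> > 0" "\<And>t. dist t t0 < \<eta> \<Longrightarrow> dist (E t) (E t0) < e / 2"
      using \<open>isCont E t0\<close> e unfolding continuous_at_eps_delta by (metis half_gt_zero)
    \<comment> \<open>Radius at most 1/2 keeps two parameters within distance 1, the range in which
      \<open>arc_le_chord\<close> applies.\<close>
    define \<theta> where "\<theta> = min \<eta> (1/2)"
    have lip: "norm (\<psi> s - \<psi> t) \<le> e / 2 * norm (s - t)" if "s \<in> ball t0 \<theta>" "t \<in> ball t0 \<theta>" for s t
    proof (rule differentiable_bound[OF convex_ball _ _ that])
      fix x assume x: "x \<in> ball t0 \<theta>"
      show "(\<psi> has_derivative (\<lambda>h. h *\<^sub>R E x)) (at x within ball t0 \<theta>)"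
        using E[of x] has_derivative_at_withinI unfolding has_vector_derivative_def by blast
      have "norm (E x) \<le> e / 2"
        using \<eta>(2)[of x] x by (simp add: E0 dist_commute \<theta>_def)
      then show "onorm (\<lambda>h. h *\<^sub>R E x) \<le> e / 2"
        using mult_left_mono[of "norm (E x)" "e / 2"]
        by (intro onorm_le) (simp only: norm_scaleR real_norm_def mult.commute[of "e / 2"] abs_ge_zero)
    qed
    \<comment> \<open>Parameters near \<open>t0\<close> are read off after rotating \<open>q\<close>
      to 1, far from the branch cut of \<open>Arg\<close>.\<close>
    have "isCont Arg 1" by (rule continuous_at_Arg) simp
    moreover have "\<theta> > 0" using \<eta> by (simp add: \<theta>_def)
    ultimately obtain d where d: "d > 0" "\<And>z. dist z 1 < d \<Longrightarrow> dist (Arg z) (Arg 1) < \<theta>"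
      unfolding continuous_at_eps_delta by metis
    have param: "\<exists>t\<in>ball t0 \<theta>. cis t = z" if z: "z \<in> S1" "dist z q < d" for z
    proof
      have "q \<noteq> 0" "norm q = 1" using q by auto
      then have "dist (z / q) 1 = dist z q"
        using norm_divide[of "z - q" q] by (simp add: dist_norm diff_divide_distrib)
      then have "dist (Arg (z / q)) (Arg 1) < \<theta>" using d z by simp
      then show "t0 + Arg (z / q) \<in> ball t0 \<theta>" by (simp add: dist_real_def)
      have "cis (Arg (z / q)) = z / q" using z q by (intro circle_cis) (simp add: norm_divide)
      then show "cis (t0 + Arg (z / q)) = z" using \<open>q \<noteq> 0\<close> by (simp add: cis_mult[symmetric] t0)
    qed
    show "\<exists>d>0. \<forall>z\<in>S1. \<forall>w\<in>S1. dist z q < d \<longrightarrow> dist w q < d \<longrightarrow>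
         norm (f z - f w - of_real r * (z - w)) \<le> e * norm (z - w)"
    proof (intro exI[of _ d] conjI ballI impI)
      fix z w assume zw: "z \<in> S1" "w \<in> S1" "dist z q < d" "dist w q < d"
      obtain s t where s: "s \<in> ball t0 \<theta>" "cis s = z" and t: "t \<in> ball t0 \<theta>" "cis t = w"
        using param zw by meson
      have "\<bar>s - t\<bar> \<le> 1" using s(1) t(1) unfolding mem_ball dist_real_def \<theta>_def by linarith
      then have "\<bar>s - t\<bar> \<le> 2 * norm (z - w)" using arc_le_chord s t by blast
      then have "e / 2 * norm (s - t) \<le> e / 2 * (2 * norm (z - w))"
        using e by (intro mult_left_mono) auto
      moreover have "\<psi> s - \<psi> t = f z - f w - of_real r * (z - w)"
        by (simp add: \<psi>_def \<phi>_def s t algebra_simps)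
      ultimately show "norm (f z - f w - of_real r * (z - w)) \<le> e * norm (z - w)"
        using lip[OF s(1) t(1)] by simp
    qed (rule d)
  qed
  then show ?thesis by (rule that)
qed

lemma circle_derivative_unique:
  assumes "q \<in> S1" "(f has_field_derivative D) (at q within S1)" "(f has_field_derivative E) (at q within S1)"
  shows "D = E"
proof -
  have "q islimpt S1"
  proof (rule connected_imp_perfect)
    show "connected S1" by (rule connected_sphere) simp
    have q: "- q \<in> S1" "- q \<noteq> q" using assms(1) by auto
    show "S1 \<noteq> {x}" for x
    proof
      assume "S1 = {x}"
      then have "- q = x" "q = x" using q(1) assms(1) unfolding \<open>S1 = {x}\<close> by (simp_all only: singleton_iff)
      then show False using q(2) by simp
    qed
  qed (rule assms(1))
  then have "at q within S1 \<noteq> bot" by (simp add: trivial_limit_within)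
  then show ?thesis using assms(2,3) unfolding has_field_derivative_iff by (rule tendsto_unique)
qed

lemma linear_combination_split:
  fixes a b x y z m n m' n' :: complex
  shows "y + z - ((m + m') * a + (n + n') * b) =
    (x - (m * a + n * b)) + (y - (m' * a + n' * b)) + (z - x)"
  by algebra

lemma linear_combination_inverse:
  fixes a b x y m n :: complex
  shows "y - (- m * a + - n * b) = - ((x - (m * a + n * b)) + (- x - y))"
  by algebra

lemma linear_combination_diff:
  fixes a b x m n m' n' :: complex
  shows "(m - m') * a + (n - n') * b = (x - (m' * a + n' * b)) - (x - (m * a + n * b))"
  by algebra

text \<open>x^4 - x factors as x (x - 1) (x^2 + x + 1), and the quadratic is positive on the reals.
  Derivatives along the circle at a fixed point are real numbers, so other cube roots of unity do
  not arise.\<close>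

lemma fourth_power_eq_self: "(x::real) ^ 4 = x \<Longrightarrow> x \<noteq> 0 \<Longrightarrow> x = 1"
proof -
  assume "x ^ 4 = x" "x \<noteq> 0"
  then have "x * ((x - 1) * (x\<^sup>2 + x + 1)) = 0" by (simp add: eval_nat_numeral algebra_simps)
  moreover have "x\<^sup>2 + x + 1 = (x + 1/2)\<^sup>2 + 3/4" by (simp add: power2_eq_square algebra_simps)
  then have "x\<^sup>2 + x + 1 > 0" using zero_le_power2[of "x + 1/2"] by linarith
  ultimately show "x = 1" using \<open>x \<noteq> 0\<close> by auto
qed

text \<open>The action laws are demanded on the circle only: a conjugate
  \<open>h \<circ> \<rho> x \<circ> k\<close> is not an extensional function and need not satisfy
  them elsewhere in the plane.\<close>

locale C1_circle_action = group G for G (structure) +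
  fixes \<sigma> :: "'a \<Rightarrow> complex \<Rightarrow> complex"
  assumes act_closed: "x \<in> carrier G \<Longrightarrow> z \<in> S1 \<Longrightarrow> \<sigma> x z \<in> S1"
    and act_mult: "x \<in> carrier G \<Longrightarrow> y \<in> carrier G \<Longrightarrow> z \<in> S1 \<Longrightarrow> \<sigma> (x \<otimes> y) z = \<sigma> x (\<sigma> y z)"
    and act_one: "z \<in> S1 \<Longrightarrow> \<sigma> \<one> z = z"
    and act_C1: "x \<in> carrier G \<Longrightarrow> C1_on_S1 (\<sigma> x)"
begin

definition stab :: "complex \<Rightarrow> 'a set" where
  "stab q = {x \<in> carrier G. \<sigma> x q = q}"

lemma stab_closed: "x \<in> stab q \<Longrightarrow> x \<in> carrier G" "x \<in> stab q \<Longrightarrow> \<sigma> x q = q"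
  by (auto simp: stab_def)

lemma stab_mult: "q \<in> S1 \<Longrightarrow> x \<in> stab q \<Longrightarrow> y \<in> stab q \<Longrightarrow> x \<otimes> y \<in> stab q"
  by (auto simp: stab_def act_mult)

lemma stab_inv: "q \<in> S1 \<Longrightarrow> x \<in> stab q \<Longrightarrow> inv x \<in> stab q"
  using act_mult[of "inv x" x q] act_one[of q] by (auto simp: stab_def)

text \<open>The derivative along the circle at a fixed point. The choice is harmless, as
  \<open>circle_derivative_unique\<close> admits only one value.\<close>

definition mult_at :: "complex \<Rightarrow> 'a \<Rightarrow> real" where
  "mult_at q x = (SOME r. strictly_differentiable S1 q (\<sigma> x) (of_real r))"

lemma strictly_differentiable_mult_at:
  assumes "q \<in> S1" "x \<in> stab q"
  shows "strictly_differentiable S1 q (\<sigma> x) (of_real (mult_at q x))"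
proof -
  obtain r :: real where "strictly_differentiable S1 q (\<sigma> x) (of_real r)"
    using C1_circle_strictly_differentiable[of "\<sigma> x" q] act_C1 act_closed assms stab_closed by metis
  then show ?thesis unfolding mult_at_def by (rule someI)
qed

lemma mult_at_derivative:
  assumes "q \<in> S1" "x \<in> stab q"
  shows "(\<sigma> x has_field_derivative of_real (mult_at q x)) (at q within S1)"
  by (rule strictly_differentiable_imp_derivative[OF strictly_differentiable_mult_at[OF assms] assms(1)])

lemma mult_at_mult:
  assumes q: "q \<in> S1" and x: "x \<in> stab q" and y: "y \<in> stab q"
  shows "mult_at q (x \<otimes> y) = mult_at q x * mult_at q y"
proof -
  have "(\<sigma> x has_field_derivative of_real (mult_at q x)) (at (\<sigma> y q) within (\<sigma> y ` S1))"
    using mult_at_derivative[OF q x] stab_closed[OF y] act_closed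
    by (auto intro: has_field_derivative_subset)
  then have "(\<sigma> x \<circ> \<sigma> y has_field_derivative of_real (mult_at q x) * of_real (mult_at q y)) (at q within S1)"
    by (rule DERIV_image_chain[OF _ mult_at_derivative[OF q y]])
  then have "(\<sigma> (x \<otimes> y) has_field_derivative of_real (mult_at q x) * of_real (mult_at q y)) (at q within S1)"
    by (rule has_field_derivative_transform_within[OF _ zero_less_one q])
      (use stab_closed(1)[OF x] stab_closed(1)[OF y] in \<open>simp add: act_mult\<close>)
  then have "complex_of_real (mult_at q (x \<otimes> y)) = of_real (mult_at q x) * of_real (mult_at q y)"
    using circle_derivative_unique[OF q mult_at_derivative[OF q stab_mult[OF q x y]]] by blast
  then show ?thesis by (metis of_real_eq_iff of_real_mult)
qed

lemma mult_at_one: "q \<in> S1 \<Longrightarrow> mult_at q \<one> = 1"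
proof -
  assume q: "q \<in> S1"
  then have o: "\<one> \<in> stab q" by (simp add: stab_def act_one)
  have "(\<sigma> \<one> has_field_derivative 1) (at q within S1)"
    by (rule has_field_derivative_transform_within[OF DERIV_ident zero_less_one q]) (simp add: act_one)
  then show ?thesis using circle_derivative_unique[OF q mult_at_derivative[OF q o]] by fastforce
qed

lemma mult_at_inv: "q \<in> S1 \<Longrightarrow> x \<in> stab q \<Longrightarrow> mult_at q (inv x) * mult_at q x = 1"
  using mult_at_mult[of q "inv x" x] stab_inv stab_closed mult_at_one by simp

section \<open>Displacements near fixed points with derivative 1\<close>

definition displacement :: "'a \<Rightarrow> complex \<Rightarrow> complex" where
  "displacement x z = \<sigma> x z - z"

lemma displacement_mult:
  "x \<in> carrier G \<Longrightarrow> y \<in> carrier G \<Longrightarrow> z \<in> S1 \<Longrightarrow>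
    displacement (x \<otimes> y) z = displacement y z + displacement x (\<sigma> y z)"
  by (simp add: displacement_def act_mult)

definition tangent_stab :: "complex \<Rightarrow> 'a set" where
  "tangent_stab q = {x \<in> stab q. mult_at q x = 1}"

lemma tangent_stab_carrier: "x \<in> tangent_stab q \<Longrightarrow> x \<in> carrier G"
  by (simp add: tangent_stab_def stab_def)

lemma tangent_stab_mult: "q \<in> S1 \<Longrightarrow> x \<in> tangent_stab q \<Longrightarrow> y \<in> tangent_stab q \<Longrightarrow> x \<otimes> y \<in> tangent_stab q"
  by (simp add: tangent_stab_def stab_mult mult_at_mult)

lemma tangent_stab_inv: "q \<in> S1 \<Longrightarrow> x \<in> tangent_stab q \<Longrightarrow> inv x \<in> tangent_stab q"
  using mult_at_inv[of q x] by (simp add: tangent_stab_def stab_inv)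

text \<open>When the derivative is 1, the strict derivative estimate at a pair of points bounds
  exactly the difference of the two displacements of \<open>x\<close>. The pair used is
  \<open>z\<close> and \<open>\<sigma> y z\<close>, whose distance is the displacement of
  \<open>y\<close>.\<close>

lemma tangent_displacement:
  assumes q: "q \<in> S1" and x: "x \<in> tangent_stab q" and y: "y \<in> tangent_stab q" and e: "e > 0"
  shows "\<exists>d>0. \<forall>z\<in>S1. dist z q < d \<longrightarrow>
    norm (displacement x (\<sigma> y z) - displacement x z) \<le> e * norm (displacement y z)"
proof -
  have sd: "strictly_differentiable S1 q (\<sigma> x) 1" "strictly_differentiable S1 q (\<sigma> y) 1"
    using strictly_differentiable_mult_at[OF q, of x] strictly_differentiable_mult_at[OF q, of y] x y
    by (auto simp: tangent_stab_def)
  have c: "x \<in> carrier G" "y \<in> carrier G" "\<sigma> y q = q"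
    using x y stab_closed by (auto simp: tangent_stab_def)
  obtain d where d: "d > 0" "\<And>z w. z \<in> S1 \<Longrightarrow> w \<in> S1 \<Longrightarrow> dist z q < d \<Longrightarrow> dist w q < d \<Longrightarrow>
     norm (\<sigma> x z - \<sigma> x w - 1 * (z - w)) \<le> e * norm (z - w)"
    using sd(1) e unfolding strictly_differentiable_def by meson
  obtain d' where d': "d' > 0" "\<And>z w. z \<in> S1 \<Longrightarrow> w \<in> S1 \<Longrightarrow> dist z q < d' \<Longrightarrow> dist w q < d' \<Longrightarrow>
     norm (\<sigma> y z - \<sigma> y w - 1 * (z - w)) \<le> 1 * norm (z - w)"
    using sd(2) zero_less_one unfolding strictly_differentiable_def by meson
  show ?thesis
  proof (intro exI[of _ "min d' (d / 2)"] conjI ballI impI)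
    fix z assume z: "z \<in> S1" "dist z q < min d' (d / 2)"
    \<comment> \<open>With tolerance 1, \<open>y\<close> at most doubles the distance to
      \<open>q\<close>; this accounts for the radius \<open>d / 2\<close>.\<close>
    have "norm (\<sigma> y z - q - (z - q)) \<le> norm (z - q)"
      using d'(2)[of z q] z q d' c by simp
    then have "norm (\<sigma> y z - q) \<le> 2 * norm (z - q)"
      using norm_triangle_ineq[of "\<sigma> y z - q - (z - q)" "z - q"] by simp
    then have "dist (\<sigma> y z) q < d" "dist z q < d" using z d by (auto simp: dist_norm)
    then have "norm (\<sigma> x (\<sigma> y z) - \<sigma> x z - 1 * (\<sigma> y z - z)) \<le> e * norm (\<sigma> y z - z)"
      using act_closed z c by (intro d) auto
    then show "norm (displacement x (\<sigma> y z) - displacement x z) \<le> e * norm (displacement y z)"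
      by (simp add: displacement_def algebra_simps)
  qed (use d d' in auto)
qed

text \<open>Thurston's observation: near a common fixed point at which all derivatives are 1, displacements are
  additive under composition up to lower order, so a word tracks its exponent sums.\<close>
definition tracks :: "complex \<Rightarrow> 'a \<Rightarrow> 'a \<Rightarrow> 'a \<Rightarrow> complex \<Rightarrow> complex \<Rightarrow> bool" where
  "tracks q a b x m n \<longleftrightarrow> x \<in> tangent_stab q \<and> (\<forall>e>0. \<exists>d>0. \<forall>z\<in>S1. dist z q < d \<longrightarrow>
     norm (displacement x z - (m * displacement a z + n * displacement b z)) \<le>
       e * (norm (displacement a z) + norm (displacement b z)))"

lemma tracks_tangent: "tracks q a b x m n \<Longrightarrow> x \<in> tangent_stab q"
  unfolding tracks_def by (rule conjunct1)

lemma tracksD: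
  assumes "tracks q a b x m n" "e > 0"
  shows "\<exists>d>0. \<forall>z\<in>S1. dist z q < d \<longrightarrow>
     norm (displacement x z - (m * displacement a z + n * displacement b z)) \<le>
       e * (norm (displacement a z) + norm (displacement b z))"
  using assms unfolding tracks_def by meson

lemma tracks_bound:
  assumes "tracks q a b x m n"
  shows "\<exists>C>0. \<exists>d>0. \<forall>z\<in>S1. dist z q < d \<longrightarrow>
     norm (displacement x z) \<le> C * (norm (displacement a z) + norm (displacement b z))"
proof -
  obtain d where d: "d > 0" "\<forall>z\<in>S1. dist z q < d \<longrightarrow>
     norm (displacement x z - (m * displacement a z + n * displacement b z)) \<le>
       1 * (norm (displacement a z) + norm (displacement b z))"
    using tracksD[OF assms zero_less_one] by blast
  define C where "C = norm m + norm n + 1"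
  have "norm (displacement x z) \<le> C * (norm (displacement a z) + norm (displacement b z))"
    if "z \<in> S1" "dist z q < d" for z
  proof -
    have "norm (m * displacement a z + n * displacement b z) \<le>
      norm m * norm (displacement a z) + norm n * norm (displacement b z)"
      by (metis norm_mult norm_triangle_ineq)
    also have "\<dots> \<le> (norm m + norm n) * (norm (displacement a z) + norm (displacement b z))"
      by (simp add: algebra_simps)
    finally show ?thesis
      using d(2)[rule_format, OF that] norm_triangle_ineq2[of "displacement x z" "m * displacement a z + n * displacement b z"]
      by (simp add: C_def algebra_simps)
  qed
  then show ?thesis using d(1) by (intro exI[of _ C] conjI exI[of _ d]) (auto simp: C_def add_nonneg_pos)
qed

lemma tracks_perturbed:
  assumes q: "q \<in> S1" and x: "x \<in> tangent_stab q" and y: "tracks q a b y m n" and e: "e > 0"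
  shows "\<exists>d>0. \<forall>z\<in>S1. dist z q < d \<longrightarrow>
     norm (displacement x (\<sigma> y z) - displacement x z) \<le>
       e * (norm (displacement a z) + norm (displacement b z))"
proof -
  obtain C d where C: "C > 0" "d > 0" "\<forall>z\<in>S1. dist z q < d \<longrightarrow>
     norm (displacement y z) \<le> C * (norm (displacement a z) + norm (displacement b z))"
    using tracks_bound[OF y] by blast
  have yt: "y \<in> tangent_stab q" by (rule tracks_tangent[OF y])
  have eC: "e / C > 0" using e C by simp
  obtain d' where d': "d' > 0" "\<forall>z\<in>S1. dist z q < d' \<longrightarrow>
    norm (displacement x (\<sigma> y z) - displacement x z) \<le> e / C * norm (displacement y z)"
    using tangent_displacement[OF q x yt eC] by blast
  show ?thesis
  proof (intro exI[of _ "min d d'"] conjI ballI impI)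
    fix z assume z: "z \<in> S1" "dist z q < min d d'"
    have "norm (displacement x (\<sigma> y z) - displacement x z) \<le> e / C * norm (displacement y z)"
      using d' z by simp
    also have "\<dots> \<le> e / C * (C * (norm (displacement a z) + norm (displacement b z)))"
      using C z e by (intro mult_left_mono) auto
    finally show "norm (displacement x (\<sigma> y z) - displacement x z) \<le>
       e * (norm (displacement a z) + norm (displacement b z))"
      using C by simp
  qed (use C d' in simp)
qed

lemma tracks_mult:
  assumes q: "q \<in> S1" and x: "tracks q a b x m n" and y: "tracks q a b y m' n'"
  shows "tracks q a b (x \<otimes> y) (m + m') (n + n')"
  unfolding tracks_def
proof (intro conjI allI impI)
  have t: "x \<in> tangent_stab q" "y \<in> tangent_stab q" using tracks_tangent[OF x] tracks_tangent[OF y] .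
  show "x \<otimes> y \<in> tangent_stab q" by (rule tangent_stab_mult[OF q t])
  have c: "x \<in> carrier G" "y \<in> carrier G" using t by (simp_all add: tangent_stab_carrier)
  fix e :: real assume "e > 0"
  then have e: "e / 3 > 0" by simp
  obtain d1 where d1: "d1 > 0" "\<forall>z\<in>S1. dist z q < d1 \<longrightarrow>
     norm (displacement x z - (m * displacement a z + n * displacement b z)) \<le>
       e/3 * (norm (displacement a z) + norm (displacement b z))" using tracksD[OF x e] by blast
  obtain d2 where d2: "d2 > 0" "\<forall>z\<in>S1. dist z q < d2 \<longrightarrow>
     norm (displacement y z - (m' * displacement a z + n' * displacement b z)) \<le>
       e/3 * (norm (displacement a z) + norm (displacement b z))" using tracksD[OF y e] by blast
  obtain d3 where d3: "d3 > 0" "\<forall>z\<in>S1. dist z q < d3 \<longrightarrow>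
     norm (displacement x (\<sigma> y z) - displacement x z) \<le>
       e/3 * (norm (displacement a z) + norm (displacement b z))"
    using tracks_perturbed[OF q t(1) y e] by blast
  show "\<exists>d>0. \<forall>z\<in>S1. dist z q < d \<longrightarrow>
     norm (displacement (x \<otimes> y) z - ((m + m') * displacement a z + (n + n') * displacement b z)) \<le>
       e * (norm (displacement a z) + norm (displacement b z))"
  proof (intro exI[of _ "min d1 (min d2 d3)"] conjI ballI impI)
    fix z assume z: "z \<in> S1" "dist z q < min d1 (min d2 d3)"
    let ?M = "norm (displacement a z) + norm (displacement b z)"
    let ?X = "displacement x z - (m * displacement a z + n * displacement b z)"
    let ?Y = "displacement y z - (m' * displacement a z + n' * displacement b z)"
    let ?Z = "displacement x (\<sigma> y z) - displacement x z"
    have eq: "displacement (x \<otimes> y) z - ((m + m') * displacement a z + (n + n') * displacement b z) = ?X + ?Y + ?Z"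
      unfolding displacement_mult[OF c z(1)] by (rule linear_combination_split)
    have "norm (?X + ?Y + ?Z) \<le> norm ?X + norm ?Y + norm ?Z"
      using norm_triangle_ineq[of "?X + ?Y" ?Z] norm_triangle_ineq[of ?X ?Y] by linarith
    also have "\<dots> \<le> e/3 * ?M + e/3 * ?M + e/3 * ?M"
    proof (intro add_mono)
      have d: "dist z q < d1" "dist z q < d2" "dist z q < d3" using z(2) by simp_all
      show "norm ?X \<le> e/3 * ?M" by (rule d1(2)[rule_format, OF z(1) d(1)])
      show "norm ?Y \<le> e/3 * ?M" by (rule d2(2)[rule_format, OF z(1) d(2)])
      show "norm ?Z \<le> e/3 * ?M" by (rule d3(2)[rule_format, OF z(1) d(3)])
    qed
    finally show "norm (displacement (x \<otimes> y) z - ((m + m') * displacement a z + (n + n') * displacement b z)) \<le> e * ?M"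
      unfolding eq by simp
  qed (use d1 d2 d3 in auto)
qed

lemma tracks_inv:
  assumes q: "q \<in> S1" and x: "tracks q a b x m n"
  shows "tracks q a b (inv x) (- m) (- n)"
  unfolding tracks_def
proof (intro conjI allI impI)
  have "x \<in> tangent_stab q" by (rule tracks_tangent[OF x])
  with q show t: "inv x \<in> tangent_stab q" by (rule tangent_stab_inv)
  have c: "x \<in> carrier G" using \<open>x \<in> tangent_stab q\<close> by (rule tangent_stab_carrier)
  fix e :: real assume "e > 0"
  then have e: "e / 2 > 0" by simp
  obtain d1 where d1: "d1 > 0" "\<forall>z\<in>S1. dist z q < d1 \<longrightarrow>
     norm (displacement x z - (m * displacement a z + n * displacement b z)) \<le>
       e/2 * (norm (displacement a z) + norm (displacement b z))" using tracksD[OF x e] by blast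
  obtain d3 where d3: "d3 > 0" "\<forall>z\<in>S1. dist z q < d3 \<longrightarrow>
     norm (displacement (inv x) (\<sigma> x z) - displacement (inv x) z) \<le>
       e/2 * (norm (displacement a z) + norm (displacement b z))"
    using tracks_perturbed[OF q t x e] by blast
  show "\<exists>d>0. \<forall>z\<in>S1. dist z q < d \<longrightarrow>
     norm (displacement (inv x) z - (- m * displacement a z + - n * displacement b z)) \<le>
       e * (norm (displacement a z) + norm (displacement b z))"
  proof (intro exI[of _ "min d1 d3"] conjI ballI impI)
    fix z assume z: "z \<in> S1" "dist z q < min d1 d3"
    let ?M = "norm (displacement a z) + norm (displacement b z)"
    let ?X = "displacement x z - (m * displacement a z + n * displacement b z)"
    let ?Z = "displacement (inv x) (\<sigma> x z) - displacement (inv x) z"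
    have "\<sigma> (inv x) (\<sigma> x z) = z" using c z act_mult[of "inv x" x z] act_one by simp
    \<comment> \<open>The displacement of the inverse is known exactly at the image point;
      \<open>d3\<close> carries it back to \<open>z\<close> up to lower order.\<close>
    then have eq: "displacement (inv x) (\<sigma> x z) = - displacement x z" by (simp add: displacement_def)
    have eq': "displacement (inv x) z - (- m * displacement a z + - n * displacement b z) = - (?X + ?Z)"
      unfolding eq by (rule linear_combination_inverse)
    have "norm (?X + ?Z) \<le> norm ?X + norm ?Z" by (rule norm_triangle_ineq)
    also have "\<dots> \<le> e/2 * ?M + e/2 * ?M"
    proof (intro add_mono)
      have d: "dist z q < d1" "dist z q < d3" using z(2) by simp_all
      show "norm ?X \<le> e/2 * ?M" by (rule d1(2)[rule_format, OF z(1) d(1)])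
      show "norm ?Z \<le> e/2 * ?M" by (rule d3(2)[rule_format, OF z(1) d(2)])
    qed
    finally show "norm (displacement (inv x) z - (- m * displacement a z + - n * displacement b z)) \<le> e * ?M"
      unfolding eq' norm_minus_cancel by simp
  qed (use d1 d3 in auto)
qed

lemma tracks_self_left:
  assumes "a \<in> tangent_stab q" shows "tracks q a b a 1 0"
  unfolding tracks_def using assms by (intro conjI allI impI exI[of _ 1]) auto

lemma tracks_self_right:
  assumes "b \<in> tangent_stab q" shows "tracks q a b b 0 1"
  unfolding tracks_def using assms by (intro conjI allI impI exI[of _ 1]) auto

text \<open>The exponent sums are left unspecified, since they cancel when the two sides of a
  relation are compared.\<close>

lemma tracks_torus_word:
  assumes q: "q \<in> S1" and a: "a \<in> tangent_stab q" and b: "b \<in> tangent_stab q"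
  shows "\<exists>m n. tracks q a b (torus_word G a b) m n"
proof -
  note A = tracks_self_left[OF a, of b] and B = tracks_self_right[OF b, of a] and M = tracks_mult[OF q]
  show ?thesis unfolding torus_word_def
    using M[OF A M[OF A M[OF tracks_inv[OF q B] M[OF A M[OF B M[OF B tracks_inv[OF q A]]]]]]] by blast
qed

lemma tracks_diff:
  assumes x: "tracks q a b x m n" "tracks q a b x m' n'" and e: "e > 0"
  shows "\<exists>d>0. \<forall>z\<in>S1. dist z q < d \<longrightarrow>
     norm ((m - m') * displacement a z + (n - n') * displacement b z) \<le>
       e * (norm (displacement a z) + norm (displacement b z))"
proof -
  have e: "e / 2 > 0" using e by simp
  obtain d1 where d1: "d1 > 0" "\<forall>z\<in>S1. dist z q < d1 \<longrightarrow>
     norm (displacement x z - (m * displacement a z + n * displacement b z)) \<le>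
       e/2 * (norm (displacement a z) + norm (displacement b z))" using tracksD[OF x(1) e] by blast
  obtain d2 where d2: "d2 > 0" "\<forall>z\<in>S1. dist z q < d2 \<longrightarrow>
     norm (displacement x z - (m' * displacement a z + n' * displacement b z)) \<le>
       e/2 * (norm (displacement a z) + norm (displacement b z))" using tracksD[OF x(2) e] by blast
  show ?thesis
  proof (intro exI[of _ "min d1 d2"] conjI ballI impI)
    fix z assume z: "z \<in> S1" "dist z q < min d1 d2"
    let ?X = "displacement x z - (m * displacement a z + n * displacement b z)"
    let ?Y = "displacement x z - (m' * displacement a z + n' * displacement b z)"
    have eq: "(m - m') * displacement a z + (n - n') * displacement b z = ?Y - ?X"
      by (rule linear_combination_diff)
    have "norm (?Y - ?X) \<le> norm ?Y + norm ?X" by (rule norm_triangle_ineq4)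
    then show "norm ((m - m') * displacement a z + (n - n') * displacement b z) \<le>
       e * (norm (displacement a z) + norm (displacement b z))"
      unfolding eq using d1(2)[rule_format, OF z(1)] d2(2)[rule_format, OF z(1)] z(2) by simp
  qed (use d1 d2 in simp)
qed

lemma locally_trivial:
  assumes ab: "a \<in> stab q" "b \<in> stab q" and q: "q \<in> S1"
    and w: "w = torus_word G a b"
    and rel: "w \<otimes> a = a \<otimes> a \<otimes> a \<otimes> a \<otimes> w" "w \<otimes> (b \<otimes> b \<otimes> b \<otimes> b) = b \<otimes> w"
  shows "\<exists>d>0. \<forall>z\<in>S1. dist z q < d \<longrightarrow> a \<in> stab z \<and> b \<in> stab z"
proof -
  have ws: "w \<in> stab q" unfolding w torus_word_def using ab q by (intro stab_mult stab_inv) auto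
  have nz: "mult_at q x \<noteq> 0" if "x \<in> stab q" for x using mult_at_inv[OF q that] by auto
  \<comment> \<open>Derivatives at \<open>q\<close> are multiplicative, so that of \<open>w\<close>
    cancels and the one of \<open>a\<close> equals its own fourth power.\<close>
  have "mult_at q w * mult_at q a = mult_at q a ^ 4 * mult_at q w"
    using arg_cong[OF rel(1), of "mult_at q"] ab ws q
    by (simp add: mult_at_mult stab_mult eval_nat_numeral)
  then have "mult_at q a ^ 4 = mult_at q a" using nz[OF ws] by simp
  then have a: "a \<in> tangent_stab q" using fourth_power_eq_self nz ab by (simp add: tangent_stab_def)
  have "mult_at q w * mult_at q b ^ 4 = mult_at q b * mult_at q w"
    using arg_cong[OF rel(2), of "mult_at q"] ab ws q
    by (simp add: mult_at_mult stab_mult eval_nat_numeral)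
  then have "mult_at q b ^ 4 = mult_at q b" using nz[OF ws] by simp
  then have b: "b \<in> tangent_stab q" using fourth_power_eq_self nz ab by (simp add: tangent_stab_def)
  obtain m n where T: "tracks q a b w m n" using tracks_torus_word[OF q a b] w by blast
  note A = tracks_self_left[OF a, of b] and B = tracks_self_right[OF b, of a] and M = tracks_mult[OF q]
  have T1: "tracks q a b (w \<otimes> a) (m + 1) (n + 0)" by (rule M[OF T A])
  have T2: "tracks q a b (w \<otimes> a) (1 + 1 + 1 + 1 + m) (0 + 0 + 0 + 0 + n)"
    unfolding rel by (intro M A T)
  \<comment> \<open>The two sides of the relation have the same displacement but track (m + 1, n)
    and (m + 4, n). Their difference, three times the displacement of \<open>a\<close>, is therefore
    of lower order; tolerance 1 is already enough.\<close>
  obtain d1 where d1: "d1 > 0" "\<forall>z\<in>S1. dist z q < d1 \<longrightarrow>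
     norm ((1 + 1 + 1 + 1 + m - (m + 1)) * displacement a z + (0 + 0 + 0 + 0 + n - (n + 0)) * displacement b z) \<le>
       1 * (norm (displacement a z) + norm (displacement b z))"
    using tracks_diff[OF T2 T1 zero_less_one] by blast
  have T3: "tracks q a b (b \<otimes> w) (0 + m) (1 + n)" by (rule M[OF B T])
  have T4: "tracks q a b (b \<otimes> w) (m + (0 + 0 + 0 + 0)) (n + (1 + 1 + 1 + 1))"
    unfolding rel(2)[symmetric] by (intro M B T)
  obtain d2 where d2: "d2 > 0" "\<forall>z\<in>S1. dist z q < d2 \<longrightarrow>
     norm ((m + (0 + 0 + 0 + 0) - (0 + m)) * displacement a z + (n + (1 + 1 + 1 + 1) - (1 + n)) * displacement b z) \<le>
       1 * (norm (displacement a z) + norm (displacement b z))"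
    using tracks_diff[OF T4 T3 zero_less_one] by blast
  show ?thesis
  proof (intro exI[of _ "min d1 d2"] conjI ballI impI)
    fix z assume z: "z \<in> S1" "dist z q < min d1 d2"
    have "3 * norm (displacement a z) \<le> norm (displacement a z) + norm (displacement b z)"
      using d1(2)[rule_format, OF z(1)] z(2) by (simp add: norm_mult)
    moreover have "3 * norm (displacement b z) \<le> norm (displacement a z) + norm (displacement b z)"
      using d2(2)[rule_format, OF z(1)] z(2) by (simp add: norm_mult)
    \<comment> \<open>Adding the two estimates bounds three times the sum of the norms by twice that
      sum.\<close>
    ultimately have "norm (displacement a z) \<le> 0" "norm (displacement b z) \<le> 0"
      using norm_ge_zero[of "displacement a z"] norm_ge_zero[of "displacement b z"] by linarith+
    then show "a \<in> stab z" "b \<in> stab z" using ab by (auto simp: stab_def displacement_def)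
  qed (use d1 d2 in auto)
qed

lemma globally_trivial:
  assumes ab: "a \<in> stab q" "b \<in> stab q" and q: "q \<in> S1"
    and w: "w = torus_word G a b"
    and rel: "w \<otimes> a = a \<otimes> a \<otimes> a \<otimes> a \<otimes> w" "w \<otimes> (b \<otimes> b \<otimes> b \<otimes> b) = b \<otimes> w"
    and z: "z \<in> S1"
  shows "\<sigma> a z = z"
proof -
  define T where "T = {z \<in> S1. a \<in> stab z \<and> b \<in> stab z}"
  have c: "a \<in> carrier G" "b \<in> carrier G" using ab by (auto simp: stab_def)
  have "closed {z \<in> S1. \<sigma> x z = z}" if "x \<in> carrier G" for x
  proof -
    have "continuous_on S1 (\<sigma> x)"
      using act_C1[OF that] unfolding C1_on_S1_def
      by (intro continuous_on_circle C1_differentiable_imp_continuous_on)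
    then have "closed (S1 \<inter> (\<lambda>z. \<sigma> x z - z) -` {0})"
      by (intro continuous_closed_preimage continuous_intros) auto
    also have "S1 \<inter> (\<lambda>z. \<sigma> x z - z) -` {0} = {z \<in> S1. \<sigma> x z = z}" by auto
    finally show ?thesis .
  qed
  then have "closed ({z \<in> S1. \<sigma> a z = z} \<inter> {z \<in> S1. \<sigma> b z = z})" using c by (intro closed_Int) auto
  also have "{z \<in> S1. \<sigma> a z = z} \<inter> {z \<in> S1. \<sigma> b z = z} = T" using c by (auto simp: T_def stab_def)
  finally have "closedin (top_of_set S1) T" by (rule closed_subset[rotated]) (auto simp: T_def)
  moreover have "openin (top_of_set S1) T"
    unfolding openin_euclidean_subtopology_iff
  proof (intro conjI ballI)
    fix p assume "p \<in> T"
    then obtain d where "d > 0" "\<And>z. z \<in> S1 \<Longrightarrow> dist z p < d \<Longrightarrow> a \<in> stab z \<and> b \<in> stab z"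
      using locally_trivial[OF _ _ _ w rel, of p] by (auto simp: T_def)
    then show "\<exists>e>0. \<forall>x'\<in>S1. dist x' p < e \<longrightarrow> x' \<in> T" by (auto simp: T_def intro!: exI[of _ d])
  qed (auto simp: T_def)
  moreover have "connected S1" by (rule connected_sphere) simp
  moreover have "q \<in> T" using ab q by (simp add: T_def)
  ultimately have "T = S1" unfolding connected_clopen by blast
  then show ?thesis using z by (auto simp: T_def stab_def)
qed

end


section \<open>Commuting quadrupling pairs\<close>

lemma (in group_hom) hom_torus_word:
  "a \<in> carrier G \<Longrightarrow> b \<in> carrier G \<Longrightarrow> h (torus_word G a b) = torus_word H (h a) (h b)"
  by (simp add: torus_word_def)

lemma (in group) torus_word_closed:
  "a \<in> carrier G \<Longrightarrow> b \<in> carrier G \<Longrightarrow> torus_word G a b \<in> carrier G"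
  by (simp add: torus_word_def)

lemma (in group_hom) quadrupling_pair_image:
  assumes "quadrupling_pair G u v" shows "quadrupling_pair H (h u) (h v)"
proof -
  let ?w = "torus_word G (u [^]\<^bsub>G\<^esub> (3::nat)) (v [^]\<^bsub>G\<^esub> (3::nat))"
  have c: "u \<in> carrier G" "v \<in> carrier G" "?w \<in> carrier G"
    using assms by (auto simp: quadrupling_pair_def intro: G.torus_word_closed)
  have "h ?w \<otimes>\<^bsub>H\<^esub> h u = h (?w \<otimes>\<^bsub>G\<^esub> u)" using c by simp
  also have "\<dots> = h (u [^]\<^bsub>G\<^esub> (4::nat) \<otimes>\<^bsub>G\<^esub> ?w)" using assms by (simp add: quadrupling_pair_def)
  finally have 1: "h ?w \<otimes>\<^bsub>H\<^esub> h u = h u [^]\<^bsub>H\<^esub> (4::nat) \<otimes>\<^bsub>H\<^esub> h ?w"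
    using c by (simp add: hom_nat_pow)
  have "h ?w \<otimes>\<^bsub>H\<^esub> h v [^]\<^bsub>H\<^esub> (4::nat) = h (?w \<otimes>\<^bsub>G\<^esub> v [^]\<^bsub>G\<^esub> (4::nat))" using c by (simp add: hom_nat_pow)
  also have "\<dots> = h (v \<otimes>\<^bsub>G\<^esub> ?w)" using assms by (simp add: quadrupling_pair_def)
  finally have 2: "h ?w \<otimes>\<^bsub>H\<^esub> h v [^]\<^bsub>H\<^esub> (4::nat) = h v \<otimes>\<^bsub>H\<^esub> h ?w" using c by simp
  have "h ?w = torus_word H (h u [^]\<^bsub>H\<^esub> (3::nat)) (h v [^]\<^bsub>H\<^esub> (3::nat))"
    using c by (simp add: hom_torus_word hom_nat_pow)
  then show ?thesis using 1 2 c unfolding quadrupling_pair_def by auto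
qed

text \<open>The word is formed in the source and maps to the word in the target, so injectivity
  pulls both relations back. In this way an abstract copy of the group inherits relations verified
  on the circle.\<close>

lemma (in group_hom) quadrupling_pair_reflect:
  assumes inj: "inj_on h (carrier G)" and c: "u \<in> carrier G" "v \<in> carrier G"
    and q: "quadrupling_pair H (h u) (h v)"
  shows "quadrupling_pair G u v"
proof -
  let ?w = "torus_word G (u [^]\<^bsub>G\<^esub> (3::nat)) (v [^]\<^bsub>G\<^esub> (3::nat))"
  have w: "?w \<in> carrier G" using c by (auto intro: G.torus_word_closed)
  have hw: "h ?w = torus_word H (h u [^]\<^bsub>H\<^esub> (3::nat)) (h v [^]\<^bsub>H\<^esub> (3::nat))"
    using c by (simp add: hom_torus_word hom_nat_pow)
  have "h (?w \<otimes>\<^bsub>G\<^esub> u) = h (u [^]\<^bsub>G\<^esub> (4::nat) \<otimes>\<^bsub>G\<^esub> ?w)"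
    "h (?w \<otimes>\<^bsub>G\<^esub> v [^]\<^bsub>G\<^esub> (4::nat)) = h (v \<otimes>\<^bsub>G\<^esub> ?w)"
    using q c w unfolding quadrupling_pair_def by (simp_all add: hom_nat_pow hw)
  then have "?w \<otimes>\<^bsub>G\<^esub> u = u [^]\<^bsub>G\<^esub> (4::nat) \<otimes>\<^bsub>G\<^esub> ?w"
    "?w \<otimes>\<^bsub>G\<^esub> v [^]\<^bsub>G\<^esub> (4::nat) = v \<otimes>\<^bsub>G\<^esub> ?w"
    using inj_onD[OF inj] w c by auto
  then show ?thesis using c unfolding quadrupling_pair_def by auto
qed

text \<open>This puts the relation for \<open>v\<close> into the form required by
  \<open>cube_has_fixed_lift\<close>, with the inverse of the word as conjugating element.\<close>

lemma (in group) quadrupling_pair_inv: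
  assumes "quadrupling_pair G u v" "w = torus_word G (u [^] (3::nat)) (v [^] (3::nat))"
  shows "w \<in> carrier G" "inv w \<otimes> v = v [^] (4::nat) \<otimes> inv w"
proof -
  have c: "u \<in> carrier G" "v \<in> carrier G" and r: "w \<otimes> v [^] (4::nat) = v \<otimes> w"
    using assms by (auto simp: quadrupling_pair_def)
  show w: "w \<in> carrier G" unfolding assms(2) using c by (auto intro: torus_word_closed)
  have "inv w \<otimes> v = inv w \<otimes> (v \<otimes> w) \<otimes> inv w" using w c by (simp add: m_assoc)
  also have "\<dots> = v [^] (4::nat) \<otimes> inv w" unfolding r[symmetric] using w c by (simp add: m_assoc[symmetric])
  finally show "inv w \<otimes> v = v [^] (4::nat) \<otimes> inv w" .
qed

lemma (in group) intertwine_pow: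
  assumes c: "w \<in> carrier G" "x \<in> carrier G" "y \<in> carrier G" and r: "w \<otimes> x = y \<otimes> w"
  shows "w \<otimes> x [^] (n::nat) = y [^] n \<otimes> w"
proof (induction n)
  case (Suc n)
  have "w \<otimes> x [^] Suc n = (w \<otimes> x [^] n) \<otimes> x" using c by (simp add: m_assoc)
  also have "\<dots> = y [^] n \<otimes> (w \<otimes> x)" using c by (simp add: Suc m_assoc)
  also have "\<dots> = y [^] Suc n \<otimes> w" using c by (simp add: r m_assoc)
  finally show ?case .
qed (use c in simp)

lemma (in group) quadrupling_pair_cubes:
  assumes "quadrupling_pair G u v" "a = u [^] (3::nat)" "b = v [^] (3::nat)" "w = torus_word G a b"
  shows "w \<otimes> a = a \<otimes> a \<otimes> a \<otimes> a \<otimes> w" "w \<otimes> (b \<otimes> b \<otimes> b \<otimes> b) = b \<otimes> w"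
proof -
  have c: "u \<in> carrier G" "v \<in> carrier G" and r: "w \<otimes> u = u [^] (4::nat) \<otimes> w" "w \<otimes> v [^] (4::nat) = v \<otimes> w"
    using assms by (auto simp: quadrupling_pair_def)
  have w: "w \<in> carrier G" unfolding assms using c by (auto intro: torus_word_closed)
  have "w \<otimes> u [^] (3::nat) = (u [^] (4::nat)) [^] (3::nat) \<otimes> w"
    by (rule intertwine_pow) (use r c w in auto)
  then show "w \<otimes> a = a \<otimes> a \<otimes> a \<otimes> a \<otimes> w"
    using c w by (simp add: assms(2) nat_pow_pow nat_pow_mult)
  have "w \<otimes> (v [^] (4::nat)) [^] (3::nat) = v [^] (3::nat) \<otimes> w"
    by (rule intertwine_pow) (use r c w in auto)
  then show "w \<otimes> (b \<otimes> b \<otimes> b \<otimes> b) = b \<otimes> w"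
    using c w by (simp add: assms(3) nat_pow_pow nat_pow_mult)
qed

lemma quadrupling_pair_fixed_lifts:
  assumes "quadrupling_pair HomeoPlus_S1 u v"
    and "f \<in> {u [^]\<^bsub>HomeoPlus_S1\<^esub> (3::nat), v [^]\<^bsub>HomeoPlus_S1\<^esub> (3::nat)}"
  shows "\<exists>F p. circle_lift f F \<and> F p = p"
proof -
  interpret group HomeoPlus_S1 by (rule group_HomeoPlus_S1)
  define w where "w = torus_word HomeoPlus_S1 (u [^]\<^bsub>HomeoPlus_S1\<^esub> (3::nat)) (v [^]\<^bsub>HomeoPlus_S1\<^esub> (3::nat))"
  note i = quadrupling_pair_inv[OF assms(1) w_def]
  have c: "u \<in> carrier HomeoPlus_S1" "v \<in> carrier HomeoPlus_S1"
    "w \<otimes>\<^bsub>HomeoPlus_S1\<^esub> u = u [^]\<^bsub>HomeoPlus_S1\<^esub> (4::nat) \<otimes>\<^bsub>HomeoPlus_S1\<^esub> w"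
    using assms(1) by (auto simp: quadrupling_pair_def w_def)
  show ?thesis
    using assms(2) cube_has_fixed_lift[OF c(1) i(1) c(3)] cube_has_fixed_lift[OF c(2) inv_closed[OF i(1)] i(2)]
    by (metis insertE singletonD)
qed

text \<open>The conjugate action is C^1 and the cubes fix \<open>h q\<close> in it, so the local
  analysis spreads over the circle. Undoing the conjugation shows that the cube acts trivially, and
  the injectivity of \<open>\<rho>\<close> finishes.\<close>

lemma C1_action_cube_trivial:
  assumes G: "group G" and \<rho>: "\<rho> \<in> mon G HomeoPlus_S1" and C1: "conjugate_to_C1_action G \<rho>"
    and uv: "quadrupling_pair G u v" and q: "q \<in> S1"
    and fixq: "\<rho> (u [^]\<^bsub>G\<^esub> (3::nat)) q = q" "\<rho> (v [^]\<^bsub>G\<^esub> (3::nat)) q = q"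
  shows "u [^]\<^bsub>G\<^esub> (3::nat) = \<one>\<^bsub>G\<^esub>"
proof -
  interpret group G by (rule G)
  interpret r: group_hom G HomeoPlus_S1 \<rho>
    by (intro group_hom.intro group_hom_axioms.intro G group_HomeoPlus_S1) (use \<rho> in \<open>simp add: mon_def\<close>)
  obtain h k where hk: "homeomorphism S1 S1 h k" and dif: "\<And>x. x \<in> carrier G \<Longrightarrow> C1_diffeo_S1 (h \<circ> \<rho> x \<circ> k)"
    using C1 unfolding conjugate_to_C1_action_def by blast
  have h: "\<And>z. z \<in> S1 \<Longrightarrow> h z \<in> S1" "\<And>z. z \<in> S1 \<Longrightarrow> k z \<in> S1"
    "\<And>z. z \<in> S1 \<Longrightarrow> k (h z) = z" "\<And>z. z \<in> S1 \<Longrightarrow> h (k z) = z"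
    using hk unfolding homeomorphism_def by blast+
  have cl: "\<rho> x z \<in> S1" if "x \<in> carrier G" "z \<in> S1" for x z
    by (rule HomeoPlus_S1_closed[OF r.hom_closed[OF that(1)] that(2)])
  define \<sigma> where "\<sigma> x = h \<circ> \<rho> x \<circ> k" for x
  interpret C1_circle_action G \<sigma>
  proof
    fix x z assume xz: "x \<in> carrier G" "z \<in> S1"
    show "\<sigma> x z \<in> S1" unfolding \<sigma>_def o_apply by (intro h cl xz)
    fix y assume y: "y \<in> carrier G"
    have "\<rho> (x \<otimes>\<^bsub>G\<^esub> y) (k z) = \<rho> x (\<rho> y (k z))"
      unfolding r.hom_mult[OF xz(1) y] mult_HomeoPlus_S1[OF r.hom_closed[OF xz(1)] r.hom_closed[OF y]]
      by (rule compose_eq) (rule h(2)[OF xz(2)])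
    moreover have "k (h (\<rho> y (k z))) = \<rho> y (k z)" by (intro h cl xz y)
    ultimately show "\<sigma> (x \<otimes>\<^bsub>G\<^esub> y) z = \<sigma> x (\<sigma> y z)" unfolding \<sigma>_def o_apply by simp
  next
    fix z assume z: "z \<in> S1"
    have "\<rho> \<one>\<^bsub>G\<^esub> (k z) = k z" unfolding r.hom_one one_HomeoPlus_S1 by (rule restrict_apply') (rule h(2)[OF z])
    then show "\<sigma> \<one>\<^bsub>G\<^esub> z = z" unfolding \<sigma>_def o_apply using h(4)[OF z] by simp
  next
    fix x assume "x \<in> carrier G"
    then show "C1_on_S1 (\<sigma> x)" unfolding \<sigma>_def using dif unfolding C1_diffeo_S1_def by blast
  qed
  define a b where "a = u [^]\<^bsub>G\<^esub> (3::nat)" and "b = v [^]\<^bsub>G\<^esub> (3::nat)"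
  have c: "a \<in> carrier G" "b \<in> carrier G" using uv by (auto simp: quadrupling_pair_def a_def b_def)
  have "\<sigma> a (h q) = h q" "\<sigma> b (h q) = h q"
    using fixq h(3)[OF q] by (simp_all add: \<sigma>_def a_def b_def)
  then have st: "a \<in> stab (h q)" "b \<in> stab (h q)" using c by (auto simp: stab_def)
  have triv: "\<sigma> a z = z" if "z \<in> S1" for z
    by (rule globally_trivial[OF st h(1)[OF q] refl quadrupling_pair_cubes[OF uv a_def b_def refl] that])
  have "\<rho> a = \<rho> \<one>\<^bsub>G\<^esub>"
  proof (rule HomeoPlus_S1_ext)
    fix z assume z: "z \<in> S1"
    have "h (\<rho> a z) = h z" using triv[OF h(1)[OF z]] h(3)[OF z] by (simp add: \<sigma>_def)
    then have "\<rho> a z = z" using h(3)[OF cl[OF c(1) z]] h(3)[OF z] by simp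
    then show "\<rho> a z = \<rho> \<one>\<^bsub>G\<^esub> z" using z by (simp add: one_HomeoPlus_S1)
  qed (use c in auto)
  moreover have "inj_on \<rho> (carrier G)" using \<rho> by (simp add: mon_def)
  ultimately show ?thesis unfolding a_def[symmetric] using c(1) one_closed by (rule_tac inj_onD)
qed

lemma commuting_quadrupling_pairs_not_C1:
  assumes G: "group G" and \<rho>: "\<rho> \<in> mon G HomeoPlus_S1" and C1: "conjugate_to_C1_action G \<rho>"
    and uv: "quadrupling_pair G u v" and uv': "quadrupling_pair G u' v'"
    and com: "\<And>x y. x \<in> {u, v} \<Longrightarrow> y \<in> {u', v'} \<Longrightarrow> y \<otimes>\<^bsub>G\<^esub> x = x \<otimes>\<^bsub>G\<^esub> y"
  shows "u [^]\<^bsub>G\<^esub> (3::nat) = \<one>\<^bsub>G\<^esub> \<or> u' [^]\<^bsub>G\<^esub> (3::nat) = \<one>\<^bsub>G\<^esub>"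
proof -
  interpret group G by (rule G)
  interpret r: group_hom G HomeoPlus_S1 \<rho>
    by (intro group_hom.intro group_hom_axioms.intro G group_HomeoPlus_S1) (use \<rho> in \<open>simp add: mon_def\<close>)
  have c: "u \<in> carrier G" "v \<in> carrier G" "u' \<in> carrier G" "v' \<in> carrier G"
    using uv uv' by (auto simp: quadrupling_pair_def)
  have cp: "y [^]\<^bsub>G\<^esub> n \<otimes>\<^bsub>G\<^esub> x [^]\<^bsub>G\<^esub> n = x [^]\<^bsub>G\<^esub> n \<otimes>\<^bsub>G\<^esub> y [^]\<^bsub>G\<^esub> n"
    if "x \<in> {u, v}" "y \<in> {u', v'}" for x y and n :: nat
  proof -
    have xy: "x \<in> carrier G" "y \<in> carrier G" using that c by auto
    have "y \<otimes>\<^bsub>G\<^esub> x [^]\<^bsub>G\<^esub> n = x [^]\<^bsub>G\<^esub> n \<otimes>\<^bsub>G\<^esub> y" by (rule intertwine_pow[OF xy(2,1,1) com[OF that]])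
    then have "x [^]\<^bsub>G\<^esub> n \<otimes>\<^bsub>G\<^esub> y [^]\<^bsub>G\<^esub> n = y [^]\<^bsub>G\<^esub> n \<otimes>\<^bsub>G\<^esub> x [^]\<^bsub>G\<^esub> n"
      using xy by (intro intertwine_pow) auto
    then show ?thesis by simp
  qed
  let ?f = "\<lambda>x. \<rho> (x [^]\<^bsub>G\<^esub> (3::nat))"
  have p: "?f x = \<rho> x [^]\<^bsub>HomeoPlus_S1\<^esub> (3::nat)" if "x \<in> carrier G" for x
    using that by (rule r.hom_nat_pow)
  have "(\<exists>q\<in>S1. ?f u q = q \<and> ?f v q = q) \<or> (\<exists>q\<in>S1. ?f u' q = q \<and> ?f v' q = q)"
  proof (rule common_fixpoint_dichotomy)
    show "{?f u, ?f v, ?f u', ?f v'} \<subseteq> carrier HomeoPlus_S1" using c by simp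
    show "\<exists>F p. circle_lift f F \<and> F p = p" if "f \<in> {?f u, ?f v, ?f u', ?f v'}" for f
    proof -
      have "f \<in> {?f u, ?f v} \<or> f \<in> {?f u', ?f v'}" using that by blast
      then show ?thesis
        unfolding p[OF c(1)] p[OF c(2)] p[OF c(3)] p[OF c(4)]
        using quadrupling_pair_fixed_lifts[OF r.quadrupling_pair_image[OF uv]]
          quadrupling_pair_fixed_lifts[OF r.quadrupling_pair_image[OF uv']] by blast
    qed
    fix f g assume "f \<in> {?f u, ?f v}" "g \<in> {?f u', ?f v'}"
    then obtain x y where xy: "x \<in> {u, v}" "y \<in> {u', v'}" "f = ?f x" "g = ?f y" by blast
    then have "x \<in> carrier G" "y \<in> carrier G" using c by auto
    then show "g \<otimes>\<^bsub>HomeoPlus_S1\<^esub> f = f \<otimes>\<^bsub>HomeoPlus_S1\<^esub> g"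
      unfolding xy(3,4) using cp[OF xy(1,2), of 3] by (simp only: r.hom_mult[symmetric] nat_pow_closed)
  qed
  then show ?thesis
    using C1_action_cube_trivial[OF G \<rho> C1 uv] C1_action_cube_trivial[OF G \<rho> C1 uv'] by blast
qed

section \<open>A copy on the naturals of a finitely generated subgroup\<close>

lemma countable_generate:
  assumes "countable S" shows "countable (generate G S)"
proof -
  \<comment> \<open>Stage \<open>n\<close> contains products of up to 2^n generators and inverses;
    each stage is countable, and their union contains the generated subgroup.\<close>
  define A where "A = rec_nat (insert \<one>\<^bsub>G\<^esub> (S \<union> m_inv G ` S))
     (\<lambda>n B. B \<union> (\<lambda>(x, y). x \<otimes>\<^bsub>G\<^esub> y) ` (B \<times> B))"
  have A: "A 0 = insert \<one>\<^bsub>G\<^esub> (S \<union> m_inv G ` S)"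
    "A (Suc n) = A n \<union> (\<lambda>(x, y). x \<otimes>\<^bsub>G\<^esub> y) ` (A n \<times> A n)" for n
    by (simp_all add: A_def)
  have c: "countable (A n)" for n by (induction n) (use assms in \<open>auto simp: A\<close>)
  have mono: "A m \<subseteq> A n" if "m \<le> n" for m n
    by (rule lift_Suc_mono_le[OF _ that]) (simp add: A)
  have "x \<in> (\<Union>n. A n)" if "x \<in> generate G S" for x
    using that
  proof induction
    case (eng x y)
    then obtain m n where "x \<in> A m" "y \<in> A n" by blast
    then have "x \<in> A (max m n)" "y \<in> A (max m n)" using mono by (meson max.cobounded1 max.cobounded2 subsetD)+
    then have "x \<otimes>\<^bsub>G\<^esub> y \<in> A (Suc (max m n))" unfolding A by force
    then show ?case by blast
  qed (use A(1) in blast)+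
  then have "generate G S \<subseteq> (\<Union>n. A n)" by blast
  moreover have "countable (\<Union>n. A n)" using c by auto
  ultimately show ?thesis by (rule countable_subset)
qed

text \<open>The subgroup generated by \<open>S\<close> is countable, so it can be numbered and its
  multiplication transported to the numbers; decoding is then the injective homomorphism.\<close>

lemma finitely_generated_nat_copy:
  assumes K: "group K" and S: "finite S" "S \<subseteq> carrier K"
  obtains G :: "nat monoid" and \<rho> where "finitely_generated_group G" "\<rho> \<in> mon G K" "S \<subseteq> \<rho> ` carrier G"
proof -
  interpret K: group K by (rule K)
  define H where "H = generate K S"
  have sub: "subgroup H K" unfolding H_def by (rule K.generate_is_subgroup[OF S(2)])
  define K' where "K' = K\<lparr>carrier := H\<rparr>"
  interpret K': group K' unfolding K'_def by (rule K.subgroup_imp_group[OF sub])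
  have cK': "carrier K' = H" by (simp add: K'_def)
  have SH: "S \<subseteq> H" unfolding H_def by (rule subsetI) (rule generate.incl)
  have HK: "H \<subseteq> carrier K" by (rule subgroup.subset[OF sub])
  have gen: "generate K' S = H" unfolding K'_def using K.generate_consistent[OF SH sub] by (simp add: H_def)
  define e where "e = to_nat_on H"
  have "countable H" unfolding H_def by (rule countable_generate) (rule countable_finite[OF S(1)])
  then have inj: "inj_on e H" unfolding e_def by (rule inj_on_to_nat_on)
  define d where "d = inv_into H e"
  have de: "d (e x) = x" if "x \<in> H" for x unfolding d_def by (rule inv_into_f_f[OF inj that])
  define G :: "nat monoid" where
    "G = \<lparr>carrier = e ` H, mult = \<lambda>x y. e (d x \<otimes>\<^bsub>K\<^esub> d y), one = e \<one>\<^bsub>K\<^esub>\<rparr>"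
  have mult: "e x \<otimes>\<^bsub>G\<^esub> e y = e (x \<otimes>\<^bsub>K\<^esub> y)" if "x \<in> H" "y \<in> H" for x y
    using that by (simp add: G_def de)
  have hom: "e \<in> hom K' G"
  proof (rule homI)
    fix x assume x: "x \<in> carrier K'"
    then show "e x \<in> carrier G" by (simp add: G_def cK')
    fix y assume "y \<in> carrier K'"
    then show "e (x \<otimes>\<^bsub>K'\<^esub> y) = e x \<otimes>\<^bsub>G\<^esub> e y" using x by (simp add: cK' mult) (simp add: K'_def)
  qed
  \<comment> \<open>The image of a group is a group in the form of a record with carrier and unit
    overwritten; for \<open>G\<close> these updates change nothing.\<close>
  have "G\<lparr>carrier := e ` carrier K', one := e \<one>\<^bsub>K'\<^esub>\<rparr> = G" by (simp add: G_def K'_def)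
  then have G: "group G" using K'.hom_imp_img_group[OF hom] by simp
  interpret e: group_hom K' G e by (intro group_hom.intro group_hom_axioms.intro G hom K'.is_group)
  have "generate G (e ` S) = e ` generate K' S" by (rule e.generate_img) (simp add: cK' SH)
  then have "generate G (e ` S) = carrier G" unfolding gen by (simp add: G_def)
  moreover have "e ` S \<subseteq> carrier G" using SH by (auto simp: G_def)
  ultimately have "finitely_generated_group G"
    unfolding finitely_generated_group_def using G S(1) by (intro conjI exI[of _ "e ` S"]) auto
  moreover have "d \<in> mon G K"
  proof -
    have "inj_on d (carrier G)" unfolding G_def using de by (auto intro!: inj_onI)
    moreover have "d \<in> hom G K"
    proof (rule homI)
      fix x assume "x \<in> carrier G"
      then show "d x \<in> carrier K" using de HK by (auto simp: G_def)
    next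
      fix x y assume "x \<in> carrier G" "y \<in> carrier G"
      then obtain x' y' where "x' \<in> H" "x = e x'" "y' \<in> H" "y = e y'" by (auto simp: G_def)
      then show "d (x \<otimes>\<^bsub>G\<^esub> y) = d x \<otimes>\<^bsub>K\<^esub> d y"
        using subgroup.m_closed[OF sub] by (simp add: mult de)
    qed
    ultimately show ?thesis by (simp add: mon_def)
  qed
  moreover have "S \<subseteq> d ` carrier G"
  proof
    fix s assume "s \<in> S"
    then have "s = d (e s)" "e s \<in> carrier G" using SH de by (auto simp: G_def)
    then show "s \<in> d ` carrier G" by (rule image_eqI)
  qed
  ultimately show ?thesis by (rule that)
qed

text \<open>After the quarter turn the vertical line has slope 0, and the conjugated shear changes
  this slope to -3.\<close>

lemma upper_shear_nontrivial: "upper_shear 3 (pi/2) \<noteq> pi/2"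
  using bump_cell[of UNIV "\<lambda>t. t - 3" 0 0] by (simp add: upper_shear_def lower_shear_def arctan_eq_zero_iff)

theorem theoremA:
  shows "\<exists>G :: nat monoid.
           finitely_generated_group G \<and>
           (\<exists>\<rho>. \<rho> \<in> mon G HomeoPlus_S1) \<and>
           (\<forall>\<rho>. \<rho> \<in> mon G HomeoPlus_S1 \<longrightarrow> \<not> conjugate_to_C1_action G \<rho>)"
proof -
  define u v where "u b = half_circle_map b (upper_shear 1)" and "v b = half_circle_map b (lower_shear (1/18))" for b
  have hom: "group_hom order_aut HomeoPlus_S1 (half_circle_map b)" for b
    by (intro group_hom.intro group_hom_axioms.intro group_order_aut group_HomeoPlus_S1 half_circle_map_hom)
  have pair: "quadrupling_pair HomeoPlus_S1 (u b) (v b)" for b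
    unfolding u_def v_def by (rule group_hom.quadrupling_pair_image[OF hom quadrupling_pair_shears])
  have com: "y \<otimes>\<^bsub>HomeoPlus_S1\<^esub> x = x \<otimes>\<^bsub>HomeoPlus_S1\<^esub> y" if "x \<in> {u True, v True}" "y \<in> {u False, v False}" for x y
    using that upper_shear_carrier[of 1] lower_shear_carrier[of "1/18"]
    unfolding u_def v_def by (auto simp del: order_aut_simps intro!: half_circle_map_commute)
  have cube: "u b [^]\<^bsub>HomeoPlus_S1\<^esub> (3::nat) \<noteq> \<one>\<^bsub>HomeoPlus_S1\<^esub>" for b
  proof -
    have "u b [^]\<^bsub>HomeoPlus_S1\<^esub> (3::nat) = half_circle_map b (upper_shear 3)"
      unfolding u_def group_hom.hom_nat_pow[OF hom upper_shear_carrier, symmetric] by (simp add: upper_shear_group)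
    then show ?thesis using half_circle_map_nontrivial[OF upper_shear_carrier upper_shear_nontrivial] by simp
  qed
  have sub: "{u True, v True, u False, v False} \<subseteq> carrier HomeoPlus_S1"
    using pair by (auto simp: quadrupling_pair_def)
  have fin: "finite {u True, v True, u False, v False}" by simp
  \<comment> \<open>\<open>\<rho>0\<close> plays the role of the inclusion of the subgroup generated
    by the four maps, and is the faithful action whose existence is claimed.\<close>
  obtain G :: "nat monoid" and \<rho>0 where G: "finitely_generated_group G" "\<rho>0 \<in> mon G HomeoPlus_S1"
    "{u True, v True, u False, v False} \<subseteq> \<rho>0 ` carrier G"
    using finitely_generated_nat_copy[OF group_HomeoPlus_S1 fin sub] .
  have grp: "group G" using G(1) by (simp add: finitely_generated_group_def)
  have rhom: "group_hom G HomeoPlus_S1 \<rho>0" and inj: "inj_on \<rho>0 (carrier G)"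
    using G(2) grp group_HomeoPlus_S1 by (auto simp: mon_def intro: group_hom.intro group_hom_axioms.intro)
  have "\<forall>b. \<exists>x\<in>carrier G. \<rho>0 x = u b" "\<forall>b. \<exists>y\<in>carrier G. \<rho>0 y = v b"
    using G(3) unfolding all_bool_eq by auto
  then obtain x y where x: "\<And>b. x b \<in> carrier G" "\<And>b. \<rho>0 (x b) = u b"
    and y: "\<And>b. y b \<in> carrier G" "\<And>b. \<rho>0 (y b) = v b" by metis
  have xy: "quadrupling_pair G (x b) (y b)" for b
    using pair[of b] by (intro group_hom.quadrupling_pair_reflect[OF rhom inj x(1) y(1)]) (simp add: x y)
  have xyc: "t \<otimes>\<^bsub>G\<^esub> s = s \<otimes>\<^bsub>G\<^esub> t" if "s \<in> {x True, y True}" "t \<in> {x False, y False}" for s t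
  proof (rule inj_onD[OF inj])
    have c: "s \<in> carrier G" "t \<in> carrier G" using that x y by auto
    then show "t \<otimes>\<^bsub>G\<^esub> s \<in> carrier G" "s \<otimes>\<^bsub>G\<^esub> t \<in> carrier G"
      using grp by (auto intro: monoid.m_closed[OF group.is_monoid])
    have "\<rho>0 s \<in> {u True, v True}" "\<rho>0 t \<in> {u False, v False}" using that x y by auto
    then show "\<rho>0 (t \<otimes>\<^bsub>G\<^esub> s) = \<rho>0 (s \<otimes>\<^bsub>G\<^esub> t)"
      using com c by (simp only: group_hom.hom_mult[OF rhom])
  qed
  have xcube: "x b [^]\<^bsub>G\<^esub> (3::nat) \<noteq> \<one>\<^bsub>G\<^esub>" for b
    using cube[of b] group_hom.hom_nat_pow[OF rhom x(1), of b 3] group_hom.hom_one[OF rhom] x(2)[of b] by metis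
  have "\<not> conjugate_to_C1_action G \<rho>" if "\<rho> \<in> mon G HomeoPlus_S1" for \<rho>
    using commuting_quadrupling_pairs_not_C1[OF grp that _ xy[of True] xy[of False] xyc] xcube by blast
  then show ?thesis using G by blast
qed

end
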